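(* The finite satisfiability problem for monadic second-order formulas with one unary function symbol is decidable: there is an algorithm that, given a monadic second-order formula $\varphi$ with one unary function symbol, decides whether $\varphi$ has a finite model.
   Context: Monadic second-order logic (MSO) extends first-order logic by quantification over subsets of the universe (set variables, with membership of elements in sets). An MSO formula with one unary function symbol is an MSO formula in a finite vocabulary such that (i) all predicate symbols, with the exception of equality, are unary, and (ii) there is only one function symbol, and it is unary (there are no constant symbols). Formulas whose models are considered are closed (sentences). *)

theory Defs
  imports "HOL-Library.Nat_Bijection"
begin

section \<open>Algorithms: Kleene's partial recursive functions\<close>

datatype recf =
    Zero
  | Succ
  | Proj nat
  | Comp recf "recf list"
  | PrimRec recf recf
  | Mu recf

text \<open>\<open>computes p xs y\<close>: the algorithm \<open>p\<close>, started on the arguments \<open>xs\<close>, halts with result \<open>y\<close>.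
  A diverging or ill-formed application computes nothing.  In \<open>Mu\<close>, all searches below the
  result have to halt (with a nonzero value), as is usual for partial minimization.\<close>

inductive computes :: "recf \<Rightarrow> nat list \<Rightarrow> nat \<Rightarrow> bool" where
  Zero: "computes Zero xs 0"
| Succ: "computes Succ [x] (Suc x)"
| Proj: "i < length xs \<Longrightarrow> computes (Proj i) xs (xs ! i)"
| Comp: "list_all2 (\<lambda>g y. computes g xs y) gs ys \<Longrightarrow> computes f ys z \<Longrightarrow>
    computes (Comp f gs) xs z"
| PrimRec_0: "computes f xs y \<Longrightarrow> computes (PrimRec f g) (0 # xs) y"
| PrimRec_Suc: "computes (PrimRec f g) (k # xs) r \<Longrightarrow> computes g (k # r # xs) y \<Longrightarrow>
    computes (PrimRec f g) (Suc k # xs) y"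
| Mu: "computes f (k # xs) 0 \<Longrightarrow> (\<And>j. j < k \<Longrightarrow> \<exists>y. computes f (j # xs) (Suc y)) \<Longrightarrow>
    computes (Mu f) xs k"

inductive_cases computes_elims:
  "computes Zero xs y"
  "computes Succ xs y"
  "computes (Proj i) xs y"
  "computes (Comp f gs) xs y"
  "computes (PrimRec f g) (0 # xs) y"
  "computes (PrimRec f g) (Suc k # xs) y"
  "computes (Mu f) xs y"

lemma computes_deterministic:
  "computes p xs y \<Longrightarrow> computes p xs z \<Longrightarrow> y = z"
proof (induction p xs y arbitrary: z rule: computes.induct)
  case (Comp xs gs ys f z')
  from Comp.prems obtain ys' where
    a: "list_all2 (\<lambda>g y. computes g xs y) gs ys'" and b: "computes f ys' z"
    by (rule computes_elims(4))
  have "ys = ys'"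
  proof (rule nth_equalityI)
    show "length ys = length ys'"
      using Comp.IH(1) a by (auto dest!: list_all2_lengthD)
    fix i assume "i < length ys"
    then show "ys ! i = ys' ! i"
      using Comp.IH(1) a by (auto simp: list_all2_conv_all_nth)
  qed
  with b Comp.IH(2) show ?case by blast
next
  case (PrimRec_Suc f g k xs r y)
  from PrimRec_Suc.prems obtain r' where
    "computes (PrimRec f g) (k # xs) r'" "computes g (k # r' # xs) z"
    by (rule computes_elims(6))
  with PrimRec_Suc.IH show ?case by blast
next
  case (Mu f k xs)
  from Mu.prems have a: "computes f (z # xs) 0"
    and b: "\<And>j. j < z \<Longrightarrow> \<exists>y. computes f (j # xs) (Suc y)"
    by (auto elim!: computes_elims(7))
  show ?case
  proof (rule linorder_cases[of k z])
    assume "k < z"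
    with b obtain y where "computes f (k # xs) (Suc y)" by blast
    with Mu.IH(1) have "0 = Suc y" by blast
    then show ?thesis by simp
  next
    assume "z < k"
    with Mu.IH(2) a have "\<exists>y. Suc y = 0" by blast
    then show ?thesis by simp
  qed
next
  case (PrimRec_0 f xs y g)
  from PrimRec_0.prems have "computes f xs z" by (rule computes_elims(5))
  with PrimRec_0.IH show ?case by blast
qed (auto elim: computes_elims(1-3))

text \<open>The decision problem "given an instance \<open>x \<in> I\<close>, does \<open>P x\<close> hold?", where instances are
  presented to the algorithm as numbers via \<open>code\<close>.\<close>

definition decidable_on :: "('a \<Rightarrow> nat) \<Rightarrow> 'a set \<Rightarrow> ('a \<Rightarrow> bool) \<Rightarrow> bool" where
  "decidable_on code I P \<longleftrightarrow>
     (\<exists>p. \<forall>x\<in>I. computes p [code x] (if P x then 1 else 0))"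


section \<open>Monadic second-order logic with one unary function symbol\<close>

datatype tm = Var nat | App tm

text \<open>\<open>App t\<close> applies the unique function symbol to \<open>t\<close>.  \<open>Pred i t\<close> is an atom with the \<open>i\<close>-th unary
  predicate symbol of the vocabulary, \<open>Mem t X\<close> is membership in the \<open>X\<close>-th set variable.
  Individual variables, set variables and predicate symbols are three separate supplies of names.
  A formula mentions only finitely many predicate symbols.\<close>

datatype fm =
    Eq tm tm
  | Pred nat tm
  | Mem tm nat
  | Neg fm
  | Conj fm fm
  | Disj fm fm
  | Imp fm fm
  | Ex nat fm
  | All nat fm
  | ExSet nat fm
  | AllSet nat fm

primrec tm_vars :: "tm \<Rightarrow> nat set" where
  "tm_vars (Var x) = {x}"
| "tm_vars (App t) = tm_vars t"

primrec free_vars :: "fm \<Rightarrow> nat set" where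
  "free_vars (Eq t u) = tm_vars t \<union> tm_vars u"
| "free_vars (Pred i t) = tm_vars t"
| "free_vars (Mem t X) = tm_vars t"
| "free_vars (Neg \<phi>) = free_vars \<phi>"
| "free_vars (Conj \<phi> \<psi>) = free_vars \<phi> \<union> free_vars \<psi>"
| "free_vars (Disj \<phi> \<psi>) = free_vars \<phi> \<union> free_vars \<psi>"
| "free_vars (Imp \<phi> \<psi>) = free_vars \<phi> \<union> free_vars \<psi>"
| "free_vars (Ex x \<phi>) = free_vars \<phi> - {x}"
| "free_vars (All x \<phi>) = free_vars \<phi> - {x}"
| "free_vars (ExSet X \<phi>) = free_vars \<phi>"
| "free_vars (AllSet X \<phi>) = free_vars \<phi>"

primrec free_set_vars :: "fm \<Rightarrow> nat set" where
  "free_set_vars (Eq t u) = {}"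
| "free_set_vars (Pred i t) = {}"
| "free_set_vars (Mem t X) = {X}"
| "free_set_vars (Neg \<phi>) = free_set_vars \<phi>"
| "free_set_vars (Conj \<phi> \<psi>) = free_set_vars \<phi> \<union> free_set_vars \<psi>"
| "free_set_vars (Disj \<phi> \<psi>) = free_set_vars \<phi> \<union> free_set_vars \<psi>"
| "free_set_vars (Imp \<phi> \<psi>) = free_set_vars \<phi> \<union> free_set_vars \<psi>"
| "free_set_vars (Ex x \<phi>) = free_set_vars \<phi>"
| "free_set_vars (All x \<phi>) = free_set_vars \<phi>"
| "free_set_vars (ExSet X \<phi>) = free_set_vars \<phi> - {X}"
| "free_set_vars (AllSet X \<phi>) = free_set_vars \<phi> - {X}"

definition sentence :: "fm \<Rightarrow> bool" where
  "sentence \<phi> \<longleftrightarrow> free_vars \<phi> = {} \<and> free_set_vars \<phi> = {}"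


subsection \<open>Semantics\<close>

text \<open>A structure interprets every predicate symbol; the interpretation of symbols that do not
  occur in a formula is irrelevant for it.\<close>

record 'a struct =
  universe :: "'a set"
  func :: "'a \<Rightarrow> 'a"
  preds :: "nat \<Rightarrow> 'a set"

definition is_struct :: "'a struct \<Rightarrow> bool" where
  "is_struct M \<longleftrightarrow> universe M \<noteq> {} \<and> (\<forall>a\<in>universe M. func M a \<in> universe M)
     \<and> (\<forall>i. preds M i \<subseteq> universe M)"

primrec tm_val :: "'a struct \<Rightarrow> (nat \<Rightarrow> 'a) \<Rightarrow> tm \<Rightarrow> 'a" where
  "tm_val M e (Var x) = e x"
| "tm_val M e (App t) = func M (tm_val M e t)"

primrec sat :: "'a struct \<Rightarrow> (nat \<Rightarrow> 'a) \<Rightarrow> (nat \<Rightarrow> 'a set) \<Rightarrow> fm \<Rightarrow> bool" where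
  "sat M e s (Eq t u) \<longleftrightarrow> tm_val M e t = tm_val M e u"
| "sat M e s (Pred i t) \<longleftrightarrow> tm_val M e t \<in> preds M i"
| "sat M e s (Mem t X) \<longleftrightarrow> tm_val M e t \<in> s X"
| "sat M e s (Neg \<phi>) \<longleftrightarrow> \<not> sat M e s \<phi>"
| "sat M e s (Conj \<phi> \<psi>) \<longleftrightarrow> sat M e s \<phi> \<and> sat M e s \<psi>"
| "sat M e s (Disj \<phi> \<psi>) \<longleftrightarrow> sat M e s \<phi> \<or> sat M e s \<psi>"
| "sat M e s (Imp \<phi> \<psi>) \<longleftrightarrow> (sat M e s \<phi> \<longrightarrow> sat M e s \<psi>)"
| "sat M e s (Ex x \<phi>) \<longleftrightarrow> (\<exists>a\<in>universe M. sat M (e(x := a)) s \<phi>)"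
| "sat M e s (All x \<phi>) \<longleftrightarrow> (\<forall>a\<in>universe M. sat M (e(x := a)) s \<phi>)"
| "sat M e s (ExSet X \<phi>) \<longleftrightarrow> (\<exists>A. A \<subseteq> universe M \<and> sat M e (s(X := A)) \<phi>)"
| "sat M e s (AllSet X \<phi>) \<longleftrightarrow> (\<forall>A. A \<subseteq> universe M \<longrightarrow> sat M e (s(X := A)) \<phi>)"

definition models :: "'a struct \<Rightarrow> fm \<Rightarrow> bool" where
  "models M \<phi> \<longleftrightarrow>
     (\<forall>e s. (\<forall>x. e x \<in> universe M) \<longrightarrow> (\<forall>X. s X \<subseteq> universe M) \<longrightarrow> sat M e s \<phi>)"

text \<open>It is enough to consider universes consisting of natural numbers: see
  \<open>finite_model_imp_has_finite_model\<close> below.\<close>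

definition has_finite_model :: "fm \<Rightarrow> bool" where
  "has_finite_model \<phi> \<longleftrightarrow>
     (\<exists>M :: nat struct. is_struct M \<and> finite (universe M) \<and> models M \<phi>)"

lemma tm_val_in_universe:
  "is_struct M \<Longrightarrow> (\<forall>x. e x \<in> universe M) \<Longrightarrow> tm_val M e t \<in> universe M"
  by (induction t) (auto simp: is_struct_def)

lemma tm_val_iso:
  assumes M: "is_struct M"
    and f: "\<forall>a\<in>universe M. func N (h a) = h (func M a)"
    and e: "\<forall>x. e x \<in> universe M"
  shows "tm_val N (\<lambda>x. h (e x)) t = h (tm_val M e t)"
  by (induction t) (auto simp: f tm_val_in_universe[OF M e])

lemma sat_iso:
  assumes M: "is_struct M"
    and inj: "inj_on h (universe M)"
    and U: "universe N = h ` universe M"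
    and f: "\<forall>a\<in>universe M. func N (h a) = h (func M a)"
    and P: "\<And>i. preds N i = h ` preds M i"
  shows "(\<forall>x. e x \<in> universe M) \<Longrightarrow> (\<forall>X. s X \<subseteq> universe M) \<Longrightarrow>
    sat N (\<lambda>x. h (e x)) (\<lambda>X. h ` s X) \<phi> \<longleftrightarrow> sat M e s \<phi>"
proof (induction \<phi> arbitrary: e s)
  case (Eq t u)
  then show ?case
    using inj tm_val_in_universe[OF M] by (simp add: tm_val_iso[OF M f] inj_on_eq_iff)
next
  case (Pred i t)
  moreover have "preds M i \<subseteq> universe M" using M by (simp add: is_struct_def)
  ultimately show ?case
    using inj tm_val_in_universe[OF M] by (simp add: tm_val_iso[OF M f] P inj_on_image_mem_iff)
next
  case (Mem t X)
  then show ?case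
    using inj tm_val_in_universe[OF M] by (simp add: tm_val_iso[OF M f] inj_on_image_mem_iff)
next
  case (Ex x \<phi>)
  have "sat N ((\<lambda>x. h (e x))(x := h a)) (\<lambda>X. h ` s X) \<phi> \<longleftrightarrow> sat M (e(x := a)) s \<phi>"
    if "a \<in> universe M" for a
  proof -
    have "(\<lambda>y. h (e y))(x := h a) = (\<lambda>y. h ((e(x := a)) y))" by auto
    moreover have "\<forall>y. (e(x := a)) y \<in> universe M" using Ex.prems that by simp
    ultimately show ?thesis
      using Ex.IH[of "e(x := a)" s] Ex.prems by (simp del: fun_upd_apply)
  qed
  then show ?case by (simp add: U)
next
  case (All x \<phi>)
  have "sat N ((\<lambda>x. h (e x))(x := h a)) (\<lambda>X. h ` s X) \<phi> \<longleftrightarrow> sat M (e(x := a)) s \<phi>"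
    if "a \<in> universe M" for a
  proof -
    have "(\<lambda>y. h (e y))(x := h a) = (\<lambda>y. h ((e(x := a)) y))" by auto
    moreover have "\<forall>y. (e(x := a)) y \<in> universe M" using All.prems that by simp
    ultimately show ?thesis
      using All.IH[of "e(x := a)" s] All.prems by (simp del: fun_upd_apply)
  qed
  then show ?case by (simp add: U)
next
  case (ExSet X \<phi>)
  have "sat N (\<lambda>x. h (e x)) ((\<lambda>X. h ` s X)(X := h ` A)) \<phi> \<longleftrightarrow> sat M e (s(X := A)) \<phi>"
    if "A \<subseteq> universe M" for A
  proof -
    have "(\<lambda>X. h ` s X)(X := h ` A) = (\<lambda>Y. h ` (s(X := A)) Y)" by (rule ext) simp
    moreover have "\<forall>Y. (s(X := A)) Y \<subseteq> universe M" using ExSet.prems that by simp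
    ultimately show ?thesis
      using ExSet.IH[of e "s(X := A)"] ExSet.prems by (simp del: fun_upd_apply)
  qed
  then show ?case by (auto simp: U subset_image_iff)
next
  case (AllSet X \<phi>)
  have "sat N (\<lambda>x. h (e x)) ((\<lambda>X. h ` s X)(X := h ` A)) \<phi> \<longleftrightarrow> sat M e (s(X := A)) \<phi>"
    if "A \<subseteq> universe M" for A
  proof -
    have "(\<lambda>X. h ` s X)(X := h ` A) = (\<lambda>Y. h ` (s(X := A)) Y)" by (rule ext) simp
    moreover have "\<forall>Y. (s(X := A)) Y \<subseteq> universe M" using AllSet.prems that by simp
    ultimately show ?thesis
      using AllSet.IH[of e "s(X := A)"] AllSet.prems by (simp del: fun_upd_apply)
  qed
  then show ?case by (auto simp: U subset_image_iff)
qed simp_all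

theorem finite_model_imp_has_finite_model:
  fixes M :: "'a struct"
  assumes M: "is_struct M" and fin: "finite (universe M)" and mod: "models M \<phi>"
  shows "has_finite_model \<phi>"
proof -
  from fin obtain h :: "'a \<Rightarrow> nat" where inj: "inj_on h (universe M)"
    using finite_imp_inj_to_nat_seg by blast
  define g where "g = inv_into (universe M) h"
  have gh: "g (h a) = a" if "a \<in> universe M" for a
    using inj that by (simp add: g_def)
  define N where
    "N = \<lparr>universe = h ` universe M, func = h \<circ> func M \<circ> g, preds = (\<lambda>i. h ` preds M i)\<rparr>"
  have N: "is_struct N"
    using M by (auto simp: is_struct_def N_def gh)
  have "sat N e s \<phi>"
    if e: "\<forall>x. e x \<in> universe N" and s: "\<forall>X. s X \<subseteq> universe N" for e s
  proof -
    have e': "\<forall>x. (g \<circ> e) x \<in> universe M" and he: "(\<lambda>x. h ((g \<circ> e) x)) = e"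
      using e by (auto simp: N_def g_def inv_into_into f_inv_into_f intro!: ext)
    have s': "\<forall>X. g ` s X \<subseteq> universe M" 
      using s unfolding N_def g_def by (fastforce intro: inv_into_into)
    have hs: "(\<lambda>X. h ` (g ` s X)) = s"
    proof
      fix X
      have "s X \<subseteq> h ` universe M" using s by (simp add: N_def)
      then show "h ` (g ` s X) = s X"
        unfolding g_def by (rule image_inv_into_cancel[OF refl])
    qed
    have "sat N (\<lambda>x. h ((g \<circ> e) x)) (\<lambda>X. h ` (g ` s X)) \<phi> \<longleftrightarrow> sat M (g \<circ> e) (\<lambda>X. g ` s X) \<phi>"
      by (rule sat_iso[OF M inj]) (use e' s' in \<open>auto simp: N_def gh\<close>)
    moreover have "sat M (g \<circ> e) (\<lambda>X. g ` s X) \<phi>"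
      using mod e' s' by (simp add: models_def)
    ultimately show ?thesis by (simp only: he hs)
  qed
  then have "models N \<phi>" by (simp add: models_def)
  with N fin show ?thesis
    unfolding has_finite_model_def by (intro exI[of _ N]) (simp add: N_def)
qed


subsection \<open>Goedel numbering\<close>

primrec tm_code :: "tm \<Rightarrow> nat" where
  "tm_code (Var x) = prod_encode (0, x)"
| "tm_code (App t) = prod_encode (1, tm_code t)"

primrec fm_code :: "fm \<Rightarrow> nat" where
  "fm_code (Eq t u) = prod_encode (0, prod_encode (tm_code t, tm_code u))"
| "fm_code (Pred i t) = prod_encode (1, prod_encode (i, tm_code t))"
| "fm_code (Mem t X) = prod_encode (2, prod_encode (tm_code t, X))"
| "fm_code (Neg \<phi>) = prod_encode (3, fm_code \<phi>)"
| "fm_code (Conj \<phi> \<psi>) = prod_encode (4, prod_encode (fm_code \<phi>, fm_code \<psi>))"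
| "fm_code (Disj \<phi> \<psi>) = prod_encode (5, prod_encode (fm_code \<phi>, fm_code \<psi>))"
| "fm_code (Imp \<phi> \<psi>) = prod_encode (6, prod_encode (fm_code \<phi>, fm_code \<psi>))"
| "fm_code (Ex x \<phi>) = prod_encode (7, prod_encode (x, fm_code \<phi>))"
| "fm_code (All x \<phi>) = prod_encode (8, prod_encode (x, fm_code \<phi>))"
| "fm_code (ExSet X \<phi>) = prod_encode (9, prod_encode (X, fm_code \<phi>))"
| "fm_code (AllSet X \<phi>) = prod_encode (10, prod_encode (X, fm_code \<phi>))"

lemma tm_code_inj: "tm_code t = tm_code u \<Longrightarrow> t = u"
proof (induction t arbitrary: u)
  case (Var x) then show ?case by (cases u) auto
next
  case (App t) then show ?case by (cases u) auto
qed

lemma fm_code_inj: "fm_code \<phi> = fm_code \<psi> \<Longrightarrow> \<phi> = \<psi>"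
  by (induction \<phi> arbitrary: \<psi>; rename_tac \<psi>', case_tac \<psi>') (auto dest: tm_code_inj)

lemma inj_fm_code: "inj fm_code"
  by (rule injI) (rule fm_code_inj)

end

theory Submission
  imports Defs
begin

text \<open>The set of rank-\<open>k\<close> monadic second-order types is finite, and a type here is a natural number below
  a tower of exponentials.  Every finite functional graph arises from one-point graphs by gluing two
  graphs along at most two marked nodes (attach a subtree to a root, close a cycle, take a disjoint
  union), and the type of a glued graph is determined by the types of its parts.  Hence the chain of
  sets of types realized by gluing terms of height at most \<open>h\<close> stabilizes as soon as \<open>h\<close> is the number
  of types, so every realizable type has a realization of computably bounded size, and every
  satisfiable sentence has such a model.  It remains to search through finitely many structures; the
  truth table of all subformulas over all these structures is a number whose correctness is expressed
  with bounded quantifiers only, so an unbounded search finds it.\<close>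

text \<open>Gluing adds an edge out of a node that had none, so intermediate graphs are not
  functional, and exchanging a part for another of the same type may produce any relation. Types
  therefore describe finite structures with a binary edge relation and a possibly empty universe.
  That the small realization is the graph of a function on a nonempty set is read off from its type
  at the end, so the rank has to leave room for this. Types know set variables only: an element is a
  singleton, and the atoms recognize singletons. Coding types as numbers gives a bound on how many
  there are and makes types over different carriers comparable. The second obstacle is that an
  algorithm is a term of Kleene's calculus. Evaluating formulas on codes directly would need
  course-of-values recursion in which the assignment varies. A table that only has to be locally
  consistent avoids this: each entry is tied to entries for immediate subformulas, and induction on
  the formula forces the whole table.\<close>

lemma set_encode_less:
  assumes "S \<subseteq> {..<b}"
  shows "set_encode S < 2 ^ b"
proof -
  have "set_encode S \<le> set_encode {..<b}"
    unfolding set_encode_def by (rule sum_mono2) (use assms in auto)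
  also have "set_encode {..<b} < 2 ^ b"
    by (induction b) (simp_all add: lessThan_Suc)
  finally show ?thesis .
qed

lemma prod_encode_mono:
  assumes "a \<le> a'" "b \<le> b'"
  shows "prod_encode (a, b) \<le> prod_encode (a', b')"
proof -
  have "mono triangle" by (auto intro: lift_Suc_mono_le simp: mono_def)
  then have "triangle (a + b) \<le> triangle (a' + b')" by (rule monoD) (use assms in simp)
  then show ?thesis using assms by (simp add: prod_encode_def)
qed

section \<open>Monadic second-order types\<close>

text \<open>With \<open>i = j\<close> the first kind of atom expresses nonemptiness. Together with
  the third kind, which says that there are two distinct elements, it recognizes the singletons that
  stand for elements.\<close>

definition atoms :: "nat \<Rightarrow> ('a \<times> 'a) set \<Rightarrow> (nat \<Rightarrow> 'a set) \<Rightarrow> nat set" where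
  "atoms m E A =
     {prod_encode (0, prod_encode (i, j)) |i j. i < m \<and> j < m \<and> A i \<inter> A j \<noteq> {}} \<union>
     {prod_encode (1, prod_encode (i, j)) |i j. i < m \<and> j < m \<and> (A i \<times> A j) \<inter> E \<noteq> {}} \<union>
     {prod_encode (2, prod_encode (i, i)) |i. i < m \<and> \<not> (\<exists>a. A i \<subseteq> {a})}"

text \<open>Hintikka types: over finite structures, equal types of rank \<open>k\<close> mean that
  Duplicator wins the Ehrenfeucht-Fraisse game with \<open>k\<close> set moves. The set chosen next
  gets the first free index \<open>m\<close>.\<close>

primrec tp :: "nat \<Rightarrow> nat \<Rightarrow> 'a set \<Rightarrow> ('a \<times> 'a) set \<Rightarrow> (nat \<Rightarrow> 'a set) \<Rightarrow> nat" where
  "tp 0 m U E A = set_encode (atoms m E A)"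
| "tp (Suc k) m U E A = set_encode ((\<lambda>X. tp k (Suc m) U E (A(m := X))) ` Pow U)"

primrec tower :: "nat \<Rightarrow> nat \<Rightarrow> nat" where
  "tower 0 b = 2 ^ b"
| "tower (Suc k) b = 2 ^ tower k b"

lemma atoms_bound: "atoms m E A \<subseteq> {..< Suc (prod_encode (2, prod_encode (m, m)))}"
proof
  fix x assume "x \<in> atoms m E A"
  then consider (a) i j where "x = prod_encode (0, prod_encode (i, j))" "i < m" "j < m"
    | (b) i j where "x = prod_encode (1, prod_encode (i, j))" "i < m" "j < m"
    | (c) i where "x = prod_encode (2, prod_encode (i, i))" "i < m"
    unfolding atoms_def by blast
  then have "x \<le> prod_encode (2, prod_encode (m, m))"
    by cases (simp_all add: prod_encode_mono)
  then show "x \<in> {..< Suc (prod_encode (2, prod_encode (m, m)))}" by simp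
qed

lemma finite_atoms: "finite (atoms m E A)"
  by (rule finite_subset[OF atoms_bound finite_lessThan])

text \<open>Each round trades one unit of rank for one named set, so \<open>m + k\<close> is
  invariant. One bound on the atoms serves at all levels and only the exponentials
  accumulate.\<close>

lemma tp_less: "tp k m U E A < tower k (Suc (prod_encode (2, prod_encode (m + k, m + k))))"
proof (induction k arbitrary: m A)
  case 0
  show ?case unfolding tp.simps tower.simps add_0_right by (rule set_encode_less[OF atoms_bound])
next
  case (Suc k)
  show ?case unfolding tp.simps tower.simps
  proof (rule set_encode_less, rule image_subsetI)
    fix X
    show "tp k (Suc m) U E (A(m := X)) \<in> {..<tower k (Suc (prod_encode (2, prod_encode (m + Suc k, m + Suc k))))}"
      using Suc[of "Suc m" "A(m := X)"] by (simp only: lessThan_iff add_Suc add_Suc_right)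
  qed
qed

lemma tp_0_eq_iff:
  "tp 0 m U E A = tp 0 m U' E' A' \<longleftrightarrow>
     (\<forall>i<m. \<forall>j<m. (A i \<inter> A j = {} \<longleftrightarrow> A' i \<inter> A' j = {})
        \<and> ((A i \<times> A j) \<inter> E = {} \<longleftrightarrow> (A' i \<times> A' j) \<inter> E' = {}))
     \<and> (\<forall>i<m. (\<exists>a. A i \<subseteq> {a}) \<longleftrightarrow> (\<exists>a. A' i \<subseteq> {a}))"
proof -
  have mem: "prod_encode (0, prod_encode (i, j)) \<in> atoms m E A \<longleftrightarrow> i < m \<and> j < m \<and> A i \<inter> A j \<noteq> {}"
    "prod_encode (1, prod_encode (i, j)) \<in> atoms m E A \<longleftrightarrow> i < m \<and> j < m \<and> (A i \<times> A j) \<inter> E \<noteq> {}"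
    "prod_encode (2, prod_encode (i, i)) \<in> atoms m E A \<longleftrightarrow> i < m \<and> \<not> (\<exists>a. A i \<subseteq> {a})"
    for i j and E :: "('x \<times> 'x) set" and A
    by (auto simp: atoms_def)
  have "tp 0 m U E A = tp 0 m U' E' A' \<longleftrightarrow> atoms m E A = atoms m E' A'"
    by (simp add: set_encode_eq finite_atoms)
  also have "\<dots> \<longleftrightarrow> (\<forall>i<m. \<forall>j<m. (A i \<inter> A j = {} \<longleftrightarrow> A' i \<inter> A' j = {})
        \<and> ((A i \<times> A j) \<inter> E = {} \<longleftrightarrow> (A' i \<times> A' j) \<inter> E' = {}))
     \<and> (\<forall>i<m. (\<exists>a. A i \<subseteq> {a}) \<longleftrightarrow> (\<exists>a. A' i \<subseteq> {a}))" (is "_ \<longleftrightarrow> ?r")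
  proof
    assume eq: "atoms m E A = atoms m E' A'"
    show ?r
    proof (intro conjI allI impI)
      fix i j assume "i < m" "j < m"
      then show "A i \<inter> A j = {} \<longleftrightarrow> A' i \<inter> A' j = {}"
        using mem(1)[of i j E A] mem(1)[of i j E' A'] eq by simp
      show "(A i \<times> A j) \<inter> E = {} \<longleftrightarrow> (A' i \<times> A' j) \<inter> E' = {}"
        using mem(2)[of i j E A] mem(2)[of i j E' A'] eq \<open>i < m\<close> \<open>j < m\<close> by simp
    next
      fix i assume "i < m"
      then show "(\<exists>a. A i \<subseteq> {a}) \<longleftrightarrow> (\<exists>a. A' i \<subseteq> {a})"
        using mem(3)[of i E A] mem(3)[of i E' A'] eq by metis
    qed
  next
    assume r: ?r
    have "(i < m \<and> j < m \<and> A i \<inter> A j \<noteq> {}) = (i < m \<and> j < m \<and> A' i \<inter> A' j \<noteq> {})"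
      "(i < m \<and> j < m \<and> (A i \<times> A j) \<inter> E \<noteq> {}) =
        (i < m \<and> j < m \<and> (A' i \<times> A' j) \<inter> E' \<noteq> {})"
      "(i < m \<and> \<not> (\<exists>a. A i \<subseteq> {a})) = (i < m \<and> \<not> (\<exists>a. A' i \<subseteq> {a}))" for i j
      using r by metis+
    then show "atoms m E A = atoms m E' A'" by (simp only: atoms_def)
  qed
  finally show ?thesis .
qed

definition rel_struct :: "'a set \<Rightarrow> ('a \<times> 'a) set \<Rightarrow> (nat \<Rightarrow> 'a set) \<Rightarrow> bool" where
  "rel_struct U E A \<longleftrightarrow> finite U \<and> E \<subseteq> U \<times> U \<and> (\<forall>i. A i \<subseteq> U)"

text \<open>The back-and-forth condition. Finiteness of the universes lets equality of the set codes
  be read as equality of the sets.\<close>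

lemma tp_Suc_eq_iff:
  assumes "finite U" "finite U'"
  shows "tp (Suc k) m U E A = tp (Suc k) m U' E' A' \<longleftrightarrow>
     (\<forall>X\<subseteq>U. \<exists>X'\<subseteq>U'. tp k (Suc m) U E (A(m := X)) = tp k (Suc m) U' E' (A'(m := X'))) \<and>
     (\<forall>X'\<subseteq>U'. \<exists>X\<subseteq>U. tp k (Suc m) U E (A(m := X)) = tp k (Suc m) U' E' (A'(m := X')))"
proof -
  have *: "f ` S = g ` S' \<longleftrightarrow> (\<forall>x\<in>S. \<exists>y\<in>S'. f x = g y) \<and> (\<forall>y\<in>S'. \<exists>x\<in>S. f x = g y)"
    for f :: "'a set \<Rightarrow> nat" and g :: "'b set \<Rightarrow> nat" and S S'
    by (auto simp: image_iff set_eq_iff) metis+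
  show ?thesis using assms by (simp add: set_encode_eq * Ball_def Bex_def)
qed

text \<open>At rank 0 Spoiler plays the empty set and the answer is forgotten. Above that, the
  induction hypothesis weakens both halves of the back-and-forth condition.\<close>

lemma tp_mono:
  assumes "finite U" "finite U'" "tp (Suc k) m U E A = tp (Suc k) m U' E' A'"
  shows "tp k m U E A = tp k m U' E' A'"
  using assms(3)
proof (induction k arbitrary: m A A')
  case 0
  then obtain X' where "tp 0 (Suc m) U E (A(m := {})) = tp 0 (Suc m) U' E' (A'(m := X'))"
    unfolding tp_Suc_eq_iff[OF assms(1,2)] by blast
  then show ?case unfolding tp_0_eq_iff by (auto simp: less_Suc_eq)
next
  case (Suc k)
  let ?same = "\<lambda>k X X'. tp k (Suc m) U E (A(m := X)) = tp k (Suc m) U' E' (A'(m := X'))"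
  have "(\<forall>X\<subseteq>U. \<exists>X'\<subseteq>U'. ?same (Suc k) X X') \<and> (\<forall>X'\<subseteq>U'. \<exists>X\<subseteq>U. ?same (Suc k) X X')"
    using Suc.prems by (rule tp_Suc_eq_iff[OF assms(1,2), THEN iffD1])
  moreover have "?same (Suc k) X X' \<Longrightarrow> ?same k X X'" for X X' by (rule Suc.IH)
  ultimately show ?case
    by (rule_tac tp_Suc_eq_iff[OF assms(1,2), THEN iffD2]) meson
qed

lemma tp_le:
  assumes "finite U" "finite U'" "tp k m U E A = tp k m U' E' A'" "j \<le> k"
  shows "tp j m U E A = tp j m U' E' A'"
  using assms(4,3)
proof (induction rule: dec_induct)
  case (step n)
  from step.IH tp_mono[OF assms(1,2) step.prems] show ?case by blast
qed

lemma image_fun_upd: "(\<lambda>i. h ` A i)(m := h ` X) = (\<lambda>i. h ` (A(m := X)) i)"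
  by (rule ext) simp

text \<open>Isomorphism invariance, by which parts can be moved onto prescribed disjoint sets of
  numbers.\<close>

lemma tp_inj_image:
  assumes "inj h"
  shows "tp k m (h ` U) (map_prod h h ` E) (\<lambda>i. h ` A i) = tp k m U E A"
proof (induction k arbitrary: m A)
  case 0
  have s: "(\<exists>a. h ` X \<subseteq> {a}) \<longleftrightarrow> (\<exists>a. X \<subseteq> {a})" for X
  proof
    assume "\<exists>a. h ` X \<subseteq> {a}"
    then have "x = y" if "x \<in> X" "y \<in> X" for x y
      using that \<open>inj h\<close> by (metis imageI injD singletonD subsetD)
    then show "\<exists>a. X \<subseteq> {a}" by blast
  qed auto
  show ?case unfolding tp_0_eq_iff s
  proof (intro conjI allI impI refl)
    fix i j
    show "h ` A i \<inter> h ` A j = {} \<longleftrightarrow> A i \<inter> A j = {}"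
      using assms by (simp flip: image_Int)
    have "(h ` A i \<times> h ` A j) \<inter> map_prod h h ` E = map_prod h h ` ((A i \<times> A j) \<inter> E)"
      using assms by (auto dest: injD)
    then show "(h ` A i \<times> h ` A j) \<inter> map_prod h h ` E = {} \<longleftrightarrow> (A i \<times> A j) \<inter> E = {}"
      by simp
  qed
next
  case (Suc k)
  have "Pow (h ` U) = (`) h ` Pow U" by (rule image_Pow_surj[symmetric]) simp
  then show ?case by (simp add: image_image image_fun_upd Suc del: fun_upd_apply)
qed

section \<open>Gluing two structures, and the composition of types\<close>

text \<open>Gluing may rename or clear the sets named below \<open>m\<close>. Being the identity
  from \<open>m\<close> on lets sets chosen in later rounds pass through unchanged, as in
  \<open>glue_sets_upd\<close>.\<close>

definition index_map :: "nat \<Rightarrow> (nat \<Rightarrow> nat) \<Rightarrow> bool" where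
  "index_map m g \<longleftrightarrow> (\<forall>i<m. g i < m) \<and> (\<forall>i\<ge>m. g i = i)"

lemma index_map_Suc: "index_map m g \<Longrightarrow> index_map (Suc m) g"
  by (auto simp: index_map_def less_Suc_eq Suc_le_eq)

text \<open>The first product lies inside the first part and can close a cycle; the second hangs the
  second part below the first. An index of an empty set switches a product off.\<close>

definition glue_edges ::
  "nat \<times> nat \<times> nat \<times> nat \<Rightarrow> ('a \<times> 'a) set \<Rightarrow> (nat \<Rightarrow> 'a set) \<Rightarrow> ('a \<times> 'a) set \<Rightarrow> (nat \<Rightarrow> 'a set) \<Rightarrow> ('a \<times> 'a) set" where
  "glue_edges q E A F B = (case q of (c, d, c', d') \<Rightarrow> E \<union> F \<union> A c \<times> A d \<union> B c' \<times> A d')"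

definition glue_sets :: "(nat \<Rightarrow> nat) \<Rightarrow> (nat \<Rightarrow> nat) \<Rightarrow> (nat \<Rightarrow> 'a set) \<Rightarrow> (nat \<Rightarrow> 'a set) \<Rightarrow> nat \<Rightarrow> 'a set" where
  "glue_sets f g A B i = A (f i) \<union> B (g i)"

text \<open>The parts are disjoint, so all mixed intersections vanish. The right-hand sides are
  built only from conditions that occur in \<open>tp_0_eq_iff\<close>; this is why emptiness of
  \<open>X\<close> appears as \<open>X \<inter> X = {}\<close>.\<close>

lemma glue_atoms:
  assumes "rel_struct U E A" "rel_struct V F B" "U \<inter> V = {}"
  shows "glue_sets f g A B i \<inter> glue_sets f g A B j = {} \<longleftrightarrow>
      A (f i) \<inter> A (f j) = {} \<and> B (g i) \<inter> B (g j) = {}"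
    and "(glue_sets f g A B i \<times> glue_sets f g A B j) \<inter> glue_edges (c, d, c', d') E A F B = {} \<longleftrightarrow>
      (A (f i) \<times> A (f j)) \<inter> E = {} \<and> (B (g i) \<times> B (g j)) \<inter> F = {} \<and>
      (A (f i) \<inter> A c = {} \<or> A (f j) \<inter> A d = {}) \<and> (B (g i) \<inter> B c' = {} \<or> A (f j) \<inter> A d' = {})"
    and "(\<exists>a. glue_sets f g A B i \<subseteq> {a}) \<longleftrightarrow>
      (\<exists>a. A (f i) \<subseteq> {a}) \<and> (\<exists>a. B (g i) \<subseteq> {a}) \<and> (A (f i) \<inter> A (f i) = {} \<or> B (g i) \<inter> B (g i) = {})"
proof -
  have A: "A i \<subseteq> U" and B: "B i \<subseteq> V" and E: "E \<subseteq> U \<times> U" and F: "F \<subseteq> V \<times> V" for i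
    using assms by (auto simp: rel_struct_def)
  have disj: "A i \<inter> B j = {}" "B j \<inter> A i = {}" for i j
    using A[of i] B[of j] assms(3) by blast+
  have dE: "(A i \<times> B j) \<inter> E = {}" "(B i \<times> A j) \<inter> E = {}" "(B i \<times> B j) \<inter> E = {}"
    and dF: "(A i \<times> B j) \<inter> F = {}" "(B i \<times> A j) \<inter> F = {}" "(A i \<times> A j) \<inter> F = {}" for i j
    using A[of i] B[of j] A[of j] B[of i] E F assms(3) by blast+
  show "glue_sets f g A B i \<inter> glue_sets f g A B j = {} \<longleftrightarrow>
      A (f i) \<inter> A (f j) = {} \<and> B (g i) \<inter> B (g j) = {}"
    unfolding glue_sets_def using disj by blast
  show "(glue_sets f g A B i \<times> glue_sets f g A B j) \<inter> glue_edges (c, d, c', d') E A F B = {} \<longleftrightarrow>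
      (A (f i) \<times> A (f j)) \<inter> E = {} \<and> (B (g i) \<times> B (g j)) \<inter> F = {} \<and>
      (A (f i) \<inter> A c = {} \<or> A (f j) \<inter> A d = {}) \<and> (B (g i) \<inter> B c' = {} \<or> A (f j) \<inter> A d' = {})"
    unfolding glue_sets_def glue_edges_def
    by (simp add: Sigma_Un_distrib1 Sigma_Un_distrib2 Int_Un_distrib Int_Un_distrib2 Un_empty
        dE dF Times_Int_Times Times_empty disj conj_ac)
  have "A (f i) = {} \<or> B (g i) = {}" if "glue_sets f g A B i \<subseteq> {a}" for a
    using that disj[of "f i" "g i"] unfolding glue_sets_def by blast
  then show "(\<exists>a. glue_sets f g A B i \<subseteq> {a}) \<longleftrightarrow>
      (\<exists>a. A (f i) \<subseteq> {a}) \<and> (\<exists>a. B (g i) \<subseteq> {a}) \<and> (A (f i) \<inter> A (f i) = {} \<or> B (g i) \<inter> B (g i) = {})"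
    unfolding glue_sets_def Int_absorb by (metis Un_empty_left Un_empty_right Un_subset_iff)
qed

lemma rel_struct_upd: "rel_struct U E A \<Longrightarrow> X \<subseteq> U \<Longrightarrow> rel_struct U E (A(m := X))"
  by (simp add: rel_struct_def)

lemma glue_sets_upd:
  assumes "index_map m f" "index_map m g"
  shows "(glue_sets f g A B)(m := X \<union> Y) = glue_sets f g (A(m := X)) (B(m := Y))"
proof
  fix i
  have "f i \<noteq> m \<and> g i \<noteq> m" if "i \<noteq> m"
    using assms that unfolding index_map_def by (metis less_irrefl not_less)
  moreover have "f m = m" "g m = m" using assms by (auto simp: index_map_def)
  ultimately show "((glue_sets f g A B)(m := X \<union> Y)) i = glue_sets f g (A(m := X)) (B(m := Y)) i"
    by (simp add: glue_sets_def)
qed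

lemma glue_edges_upd:
  assumes "c < m" "d < m" "c' < m" "d' < m"
  shows "glue_edges (c, d, c', d') E (A(m := X)) F (B(m := Y)) = glue_edges (c, d, c', d') E A F B"
  using assms by (simp add: glue_edges_def)

text \<open>One half of the back-and-forth argument, used in both directions. A set in the union
  splits into its traces on the two parts; these are answered separately and the answers are united.
  The added edges depend only on sets named below \<open>m\<close>, so the move leaves them
  alone.\<close>

lemma tp_glue_step:
  assumes f: "index_map m f" and g: "index_map m g" and q: "c < m" "d < m" "c' < m" "d' < m"
    and IH: "\<And>X Y X' Y'. X \<subseteq> U \<Longrightarrow> Y \<subseteq> V \<Longrightarrow> X' \<subseteq> U' \<Longrightarrow> Y' \<subseteq> V' \<Longrightarrow>
      tp k (Suc m) U E (A(m := X)) = tp k (Suc m) U' E' (A'(m := X')) \<Longrightarrow>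
      tp k (Suc m) V F (B(m := Y)) = tp k (Suc m) V' F' (B'(m := Y')) \<Longrightarrow>
      tp k (Suc m) (U \<union> V) (glue_edges (c, d, c', d') E (A(m := X)) F (B(m := Y)))
        (glue_sets f g (A(m := X)) (B(m := Y))) =
      tp k (Suc m) (U' \<union> V') (glue_edges (c, d, c', d') E' (A'(m := X')) F' (B'(m := Y')))
        (glue_sets f g (A'(m := X')) (B'(m := Y')))"
    and A: "\<forall>X\<subseteq>U. \<exists>X'\<subseteq>U'. tp k (Suc m) U E (A(m := X)) = tp k (Suc m) U' E' (A'(m := X'))"
    and B: "\<forall>X\<subseteq>V. \<exists>X'\<subseteq>V'. tp k (Suc m) V F (B(m := X)) = tp k (Suc m) V' F' (B'(m := X'))"
    and Z: "Z \<subseteq> U \<union> V"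
  shows "\<exists>Z'\<subseteq>U' \<union> V'. tp k (Suc m) (U \<union> V) (glue_edges (c, d, c', d') E A F B) ((glue_sets f g A B)(m := Z)) =
      tp k (Suc m) (U' \<union> V') (glue_edges (c, d, c', d') E' A' F' B') ((glue_sets f g A' B')(m := Z'))"
proof -
  obtain X' where X': "X' \<subseteq> U'" "tp k (Suc m) U E (A(m := Z \<inter> U)) = tp k (Suc m) U' E' (A'(m := X'))"
    using A by (meson Int_lower2)
  obtain Y' where Y': "Y' \<subseteq> V'" "tp k (Suc m) V F (B(m := Z \<inter> V)) = tp k (Suc m) V' F' (B'(m := Y'))"
    using B by (meson Int_lower2)
  have "Z = (Z \<inter> U) \<union> (Z \<inter> V)" using Z by blast
  then have upd: "(glue_sets f g A B)(m := Z) = glue_sets f g (A(m := Z \<inter> U)) (B(m := Z \<inter> V))"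
    using glue_sets_upd[OF f g, of A B "Z \<inter> U" "Z \<inter> V"] by simp
  show ?thesis
  proof (intro exI conjI)
    show "X' \<union> Y' \<subseteq> U' \<union> V'" using X' Y' by (intro Un_mono)
    show "tp k (Suc m) (U \<union> V) (glue_edges (c, d, c', d') E A F B) ((glue_sets f g A B)(m := Z)) =
      tp k (Suc m) (U' \<union> V') (glue_edges (c, d, c', d') E' A' F' B') ((glue_sets f g A' B')(m := X' \<union> Y'))"
      using IH[OF Int_lower2 Int_lower2 X'(1) Y'(1) X'(2) Y'(2)]
      unfolding upd glue_sets_upd[OF f g] glue_edges_upd[OF q] .
  qed
qed

text \<open>A composition theorem in the manner of Feferman and Vaught. At rank 0
  \<open>glue_atoms\<close> expresses the atoms of the whole through atoms of the parts, and a round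
  on the whole is a round on each part.\<close>

lemma tp_glue:
  assumes "rel_struct U E A" "rel_struct V F B" and UV: "U \<inter> V = {}"
    and "rel_struct U' E' A'" "rel_struct V' F' B'" and UV': "U' \<inter> V' = {}"
    and "tp k m U E A = tp k m U' E' A'" "tp k m V F B = tp k m V' F' B'"
    and "index_map m f" "index_map m g" "c < m" "d < m" "c' < m" "d' < m"
  shows "tp k m (U \<union> V) (glue_edges (c, d, c', d') E A F B) (glue_sets f g A B) =
    tp k m (U' \<union> V') (glue_edges (c, d, c', d') E' A' F' B') (glue_sets f g A' B')"
  using assms(1,2,4,5,7-)
proof (induction k arbitrary: m A B A' B')
  case (0 m A B A' B')
  have fg: "i < m \<Longrightarrow> f i < m" "i < m \<Longrightarrow> g i < m" for i
    using 0 by (auto simp: index_map_def)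
  have A: "(A i \<inter> A j = {}) = (A' i \<inter> A' j = {})" "((A i \<times> A j) \<inter> E = {}) = ((A' i \<times> A' j) \<inter> E' = {})"
    "(\<exists>a. A i \<subseteq> {a}) = (\<exists>a. A' i \<subseteq> {a})" if "i < m" "j < m" for i j
    using 0(5)[unfolded tp_0_eq_iff] that by metis+
  have B: "(B i \<inter> B j = {}) = (B' i \<inter> B' j = {})" "((B i \<times> B j) \<inter> F = {}) = ((B' i \<times> B' j) \<inter> F' = {})"
    "(\<exists>a. B i \<subseteq> {a}) = (\<exists>a. B' i \<subseteq> {a})" if "i < m" "j < m" for i j
    using 0(6)[unfolded tp_0_eq_iff] that by metis+
  show ?case unfolding tp_0_eq_iff
    unfolding glue_atoms[OF 0(1,2) UV] glue_atoms[OF 0(3,4) UV']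
    by (intro conjI allI impI) (simp_all only: A B fg 0)
next
  case (Suc k m A B A' B')
  note fin = Suc.prems(1-4)[unfolded rel_struct_def, THEN conjunct1]
  note A = Suc.prems(5)[unfolded tp_Suc_eq_iff[OF fin(1,3)]]
  note B = Suc.prems(6)[unfolded tp_Suc_eq_iff[OF fin(2,4)]]
  have IH: "tp k (Suc m) (U \<union> V) (glue_edges (c, d, c', d') E (A(m := X)) F (B(m := Y)))
        (glue_sets f g (A(m := X)) (B(m := Y))) =
      tp k (Suc m) (U' \<union> V') (glue_edges (c, d, c', d') E' (A'(m := X')) F' (B'(m := Y')))
        (glue_sets f g (A'(m := X')) (B'(m := Y')))"
    if "X \<subseteq> U" "Y \<subseteq> V" "X' \<subseteq> U'" "Y' \<subseteq> V'"
      "tp k (Suc m) U E (A(m := X)) = tp k (Suc m) U' E' (A'(m := X'))"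
      "tp k (Suc m) V F (B(m := Y)) = tp k (Suc m) V' F' (B'(m := Y'))" for X Y X' Y'
    by (rule Suc.IH)
      (use that Suc.prems in \<open>simp_all add: index_map_Suc rel_struct_upd del: fun_upd_apply tp.simps\<close>)
  have "\<exists>Z'\<subseteq>U' \<union> V'. tp k (Suc m) (U \<union> V) (glue_edges (c, d, c', d') E A F B) ((glue_sets f g A B)(m := Z)) =
      tp k (Suc m) (U' \<union> V') (glue_edges (c, d, c', d') E' A' F' B') ((glue_sets f g A' B')(m := Z'))"
    if "Z \<subseteq> U \<union> V" for Z
    by (rule tp_glue_step[OF Suc.prems(7-) IH A[THEN conjunct1] B[THEN conjunct1] that])
  moreover have "\<exists>Z\<subseteq>U \<union> V. tp k (Suc m) (U' \<union> V') (glue_edges (c, d, c', d') E' A' F' B') ((glue_sets f g A' B')(m := Z'))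
     = tp k (Suc m) (U \<union> V) (glue_edges (c, d, c', d') E A F B) ((glue_sets f g A B)(m := Z))"
    if "Z' \<subseteq> U' \<union> V'" for Z'
  proof (rule tp_glue_step[OF Suc.prems(7-) IH[symmetric] _ _ that])
    show "\<forall>X\<subseteq>U'. \<exists>X'\<subseteq>U. tp k (Suc m) U' E' (A'(m := X)) = tp k (Suc m) U E (A(m := X'))"
      using A[THEN conjunct2] by (simp only: eq_commute)
    show "\<forall>X\<subseteq>V'. \<exists>X'\<subseteq>V. tp k (Suc m) V' F' (B'(m := X)) = tp k (Suc m) V F (B(m := X'))"
      using B[THEN conjunct2] by (simp only: eq_commute)
  qed simp_all
  ultimately show ?case
    unfolding tp_Suc_eq_iff[OF finite_UnI[OF fin(1,2)] finite_UnI[OF fin(3,4)]] by metis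
qed

section \<open>Realizable types have small realizations\<close>

text \<open>The parts range over all structures with types in \<open>Y\<close>, so this is an
  operation on sets of types alone. Once the chain below repeats a stage it is therefore
  constant.\<close>

definition tp_glues :: "nat \<Rightarrow> nat \<Rightarrow> nat set \<Rightarrow> nat set" where
  "tp_glues k m Y = {tp k m (U \<union> V) (glue_edges (c, d, c', d') E A F B) (glue_sets f g A B)
     |(U :: nat set) V E A F B c d c' d' f g.
        rel_struct U E A \<and> rel_struct V F B \<and> U \<inter> V = {} \<and> tp k m U E A \<in> Y \<and> tp k m V F B \<in> Y \<and>
        index_map m f \<and> index_map m g \<and> c < m \<and> d < m \<and> c' < m \<and> d' < m}"

text \<open>Stage 0 includes the empty structure, which serves as second part when a gluing only has
  to add an edge.\<close>

primrec tp_chain :: "nat \<Rightarrow> nat \<Rightarrow> nat \<Rightarrow> nat set" where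
  "tp_chain k m 0 = {tp k m U {} A |(U :: nat set) A. (\<exists>a. U \<subseteq> {a}) \<and> (\<forall>i. A i \<subseteq> U)}"
| "tp_chain k m (Suc h) = tp_chain k m h \<union> tp_glues k m (tp_chain k m h)"

lemma rel_struct_image: "rel_struct U E A \<Longrightarrow> rel_struct (h ` U) (map_prod h h ` E) (\<lambda>i. h ` A i)"
  by (fastforce simp: rel_struct_def)

lemma rel_struct_glue:
  assumes "rel_struct U E A" "rel_struct V F B"
  shows "rel_struct (U \<union> V) (glue_edges q E A F B) (glue_sets f g A B)"
proof -
  have A: "A i \<subseteq> U" and B: "B i \<subseteq> V" and E: "E \<subseteq> U \<times> U" and F: "F \<subseteq> V \<times> V" for i
    using assms by (auto simp: rel_struct_def)
  show ?thesis unfolding rel_struct_def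
  proof (intro conjI allI)
    show "finite (U \<union> V)" using assms by (simp add: rel_struct_def)
    obtain c d c' d' where "q = (c, d, c', d')" by (cases q)
    then show "glue_edges q E A F B \<subseteq> (U \<union> V) \<times> (U \<union> V)"
      using A[of c] A[of d] B[of c'] A[of d'] E F by (auto simp: glue_edges_def)
    show "glue_sets f g A B i \<subseteq> U \<union> V" for i
      using A[of "f i"] B[of "g i"] by (auto simp: glue_sets_def)
  qed
qed

text \<open>By \<open>tp_glue\<close> each part may be exchanged for a small one of the same type,
  so one more stage at most doubles the bound on the universe.\<close>

lemma tp_chain_small:
  assumes "t \<in> tp_chain k m h"
  shows "\<exists>(U :: nat set) E A. rel_struct U E A \<and> U \<subseteq> {..<2 ^ h} \<and> tp k m U E A = t"
  using assms
proof (induction h arbitrary: t)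
  case 0
  then obtain U :: "nat set" and A where t: "t = tp k m U {} A" and U: "\<exists>a. U \<subseteq> {a}" and A: "\<forall>i. A i \<subseteq> U"
    by auto
  then obtain a where a: "U \<subseteq> {a}" by blast
  \<comment> \<open>The transposition of \<open>a\<close> and 0 moves the only possible point to
    0.\<close>
  have "\<exists>h :: nat \<Rightarrow> nat. inj h \<and> h a = 0"
    by (rule exI[of _ "(id(0 := a, a := 0))"]) (auto simp: inj_def)
  then obtain h :: "nat \<Rightarrow> nat" where h: "inj h" "h a = 0" by blast
  from tp_inj_image[OF h(1), of k m U "{}" A] t have "t = tp k m (h ` U) {} (\<lambda>i. h ` A i)" by simp
  moreover have "rel_struct (h ` U) {} (\<lambda>i. h ` A i)"
    using A a by (auto simp: rel_struct_def finite_subset)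
  moreover have "h ` U \<subseteq> {..<2 ^ 0}" using a h by auto
  ultimately show ?case by (intro exI conjI) (assumption | rule sym)+
next
  case (Suc h)
  show ?case
  proof (cases "t \<in> tp_chain k m h")
    case True
    from Suc.IH[OF this] obtain U :: "nat set" and E A where
      1: "rel_struct U E A" "U \<subseteq> {..<2 ^ h}" "tp k m U E A = t" by blast
    have "x < 2 ^ Suc h" if "x \<in> U" for x using subsetD[OF 1(2) that] by simp
    then have "U \<subseteq> {..<2 ^ Suc h}" by (intro subsetI) (simp only: lessThan_iff)
    with 1 show ?thesis by (intro exI conjI)
  next
    case False
    with Suc.prems have "t \<in> tp_glues k m (tp_chain k m h)" by simp
    then obtain U V :: "nat set" and E A F B c d c' d' f g where
      t: "t = tp k m (U \<union> V) (glue_edges (c, d, c', d') E A F B) (glue_sets f g A B)"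
      and s: "rel_struct U E A" "rel_struct V F B" "U \<inter> V = {}"
      and c: "tp k m U E A \<in> tp_chain k m h" "tp k m V F B \<in> tp_chain k m h"
      and i: "index_map m f" "index_map m g" "c < m" "d < m" "c' < m" "d' < m"
      unfolding tp_glues_def mem_Collect_eq by (elim exE conjE) (rule that; assumption)
    from Suc.IH[OF c(1)] obtain U' :: "nat set" and E' A' where
      1: "rel_struct U' E' A'" "U' \<subseteq> {..<2 ^ h}" "tp k m U' E' A' = tp k m U E A" by blast
    from Suc.IH[OF c(2)] obtain V1 :: "nat set" and F1 B1 where
      2: "rel_struct V1 F1 B1" "V1 \<subseteq> {..<2 ^ h}" "tp k m V1 F1 B1 = tp k m V F B" by blast
    \<comment> \<open>Shifting by \<open>2 ^ h\<close> makes the second part disjoint from the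
      first, and both stay below \<open>2 ^ Suc h\<close>.\<close>
    define sh :: "nat \<Rightarrow> nat" where "sh = (\<lambda>x. x + 2 ^ h)"
    have sh: "inj sh" by (simp add: sh_def inj_def)
    define V' F' B' where "V' = sh ` V1" and "F' = map_prod sh sh ` F1" and "B' = (\<lambda>i. sh ` B1 i)"
    have V': "rel_struct V' F' B'" "tp k m V' F' B' = tp k m V F B"
      unfolding V'_def F'_def B'_def tp_inj_image[OF sh] by (rule rel_struct_image[OF 2(1)], rule 2(3))
    have "V' \<subseteq> {2 ^ h..<2 ^ Suc h}" using 2(2) by (auto simp: V'_def sh_def)
    then have disj: "U' \<inter> V' = {}" and sub: "U' \<union> V' \<subseteq> {..<2 ^ Suc h}"
      using 1(2) by (force, force)
    have "t = tp k m (U' \<union> V') (glue_edges (c, d, c', d') E' A' F' B') (glue_sets f g A' B')"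
      unfolding t 
      by (rule tp_glue[OF s(1,2,3) 1(1) V'(1) disj 1(3)[symmetric] V'(2)[symmetric] i])
    with sub rel_struct_glue[OF 1(1) V'(1)] show ?thesis by (intro exI conjI) (assumption | rule sym)+
  qed
qed

lemma tp_chain_less: "t \<in> tp_chain k m h \<Longrightarrow> t < tower k (Suc (prod_encode (2, prod_encode (m + k, m + k))))"
  using tp_chain_small tp_less by metis

text \<open>All stages are subsets of \<open>{..<n}\<close>, and each determines the next. So the
  chain grows strictly until it stops for good, which happens after at most \<open>n\<close>
  steps.\<close>

lemma tp_chain_fixpoint:
  fixes k m :: nat
  defines "n \<equiv> tower k (Suc (prod_encode (2, prod_encode (m + k, m + k))))"
  shows "tp_chain k m n = (\<Union>h. tp_chain k m h)"
proof -
  have sub: "tp_chain k m h \<subseteq> {..<n}" for h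
    using tp_chain_less unfolding n_def by blast
  have "tp_chain k m (card {..<n}) = (\<Union>h. tp_chain k m h)"
  proof (rule finite_mono_strict_prefix_implies_finite_fixpoint[OF sub])
    show "\<exists>N. (\<forall>n\<le>N. \<forall>n'\<le>N. n' < n \<longrightarrow> tp_chain k m n' \<subset> tp_chain k m n) \<and>
      (\<forall>n\<ge>N. tp_chain k m N = tp_chain k m n)"
    proof (rule finite_mono_remains_stable_implies_strict_prefix)
      show "finite (range (tp_chain k m))"
        by (rule finite_subset[of _ "Pow {..<n}"]) (use sub in auto)
      show "mono (tp_chain k m)" by (rule mono_iff_le_Suc[THEN iffD2]) simp
      show "\<forall>n. tp_chain k m n = tp_chain k m (Suc n) \<longrightarrow> tp_chain k m (Suc n) = tp_chain k m (Suc (Suc n))"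
        by (metis tp_chain.simps(2))
    qed
  qed simp
  then show ?thesis by simp
qed

section \<open>Finite functional graphs are built by gluing\<close>

definition realizable :: "nat \<Rightarrow> nat \<Rightarrow> nat set" where
  "realizable k m = (\<Union>h. tp_chain k m h)"

lemma realizable_glue:
  fixes U V :: "nat set"
  assumes "rel_struct U E A" "rel_struct V F B" "U \<inter> V = {}"
    and "tp k m U E A \<in> realizable k m" "tp k m V F B \<in> realizable k m"
    and "index_map m f" "index_map m g" "c < m" "d < m" "c' < m" "d' < m"
  shows "tp k m (U \<union> V) (glue_edges (c, d, c', d') E A F B) (glue_sets f g A B) \<in> realizable k m"
proof -
  obtain n where n: "realizable k m = tp_chain k m n"
    unfolding realizable_def tp_chain_fixpoint[symmetric] by blast
  have "tp k m (U \<union> V) (glue_edges (c, d, c', d') E A F B) (glue_sets f g A B) \<in> tp_glues k m (tp_chain k m n)"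
    unfolding tp_glues_def mem_Collect_eq n[symmetric] by (intro exI conjI) (rule refl, (fact assms)+)
  then have "tp k m (U \<union> V) (glue_edges (c, d, c', d') E A F B) (glue_sets f g A B) \<in> tp_chain k m (Suc n)"
    by simp
  then show ?thesis unfolding realizable_def by (rule UN_I[OF UNIV_I])
qed

lemma realizable_single:
  fixes U :: "nat set"
  assumes "U \<subseteq> {a}" "\<forall>i. A i \<subseteq> U"
  shows "tp k m U {} A \<in> realizable k m"
proof -
  have "tp k m U {} A \<in> tp_chain k m 0" using assms by auto
  then show ?thesis unfolding realizable_def by (rule UN_I[OF UNIV_I])
qed

text \<open>Slot 0 holds the node that still lacks an outgoing edge, slot 1 the marked node; slot 2 stays
  empty, so that an index map into it clears a slot.\<close>

definition slots :: "'a set \<Rightarrow> 'a set \<Rightarrow> (nat \<Rightarrow> 'a set) \<Rightarrow> 'a set \<Rightarrow> nat \<Rightarrow> 'a set" where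
  "slots S R P U i = (if i = 0 then S else if i = 1 then R else if i = 2 then {} else P i \<inter> U)"

lemma slots_simps [simp]:
  "slots S R P U 0 = S" "slots S R P U (Suc 0) = R" "slots S R P U 2 = {}"
  by (simp_all add: slots_def)

definition graph :: "('a \<Rightarrow> 'a) \<Rightarrow> 'a set \<Rightarrow> ('a \<times> 'a) set" where
  "graph f W = (\<lambda>x. (x, f x)) ` W"

lemma graph_iff [simp]: "(x, y) \<in> graph f W \<longleftrightarrow> x \<in> W \<and> y = f x"
  by (auto simp: graph_def)

lemma rel_struct_slots:
  "finite U \<Longrightarrow> W \<subseteq> U \<Longrightarrow> f ` W \<subseteq> U \<Longrightarrow> S \<subseteq> U \<Longrightarrow> R \<subseteq> U \<Longrightarrow> rel_struct U (graph f W) (slots S R P U)"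
  by (auto simp: rel_struct_def slots_def graph_def)

lemma index_map_clear:
  assumes "3 \<le> m"
  shows "index_map m id" "index_map m (id(0 := 2))" "index_map m (id(1 := 2))" "index_map m (id(0 := 2, 1 := 2))"
  using assms by (auto simp: index_map_def)

text \<open>A tree with root \<open>s\<close> splits at a child \<open>b\<close> of the root; the marked node goes to the part that
  contains it.\<close>

lemma realizable_tree:
  fixes U :: "nat set"
  assumes m: "3 \<le> m"
  shows "finite U \<Longrightarrow> s \<in> U \<Longrightarrow> r \<in> U \<Longrightarrow> f ` (U - {s}) \<subseteq> U \<Longrightarrow>
    (\<forall>x\<in>U. (x, s) \<in> (graph f (U - {s}))\<^sup>*) \<Longrightarrow>
    tp k m U (graph f (U - {s})) (slots {s} {r} P U) \<in> realizable k m"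
proof (induction "card U" arbitrary: U s r rule: less_induct)
  case less
  let ?E = "graph f (U - {s})"
  show ?case
  proof (cases "U = {s}")
    case True
    then show ?thesis
      using less.prems by (auto simp: graph_def slots_def intro!: realizable_single[of _ s] split: if_splits)
  next
    case False
    \<comment> \<open>The split happens at the last node before \<open>s\<close> on the path from
      \<open>x0\<close>. Starting at \<open>r\<close> when \<open>r\<close> is not the root puts the
      mark into the subtree of that child.\<close>
    obtain x0 where x0: "x0 \<in> U" "x0 \<noteq> s" "r \<noteq> s \<Longrightarrow> x0 = r"
      using False less.prems(2,3) by (cases "r = s") auto
    have "(x0, s) \<in> ?E\<^sup>*" using less.prems(5) x0 by blast
    then obtain b where b0: "(x0, b) \<in> ?E\<^sup>*" and bs: "(b, s) \<in> ?E"
      using x0(2) by (metis rtranclE)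
    have b: "b \<in> U" "b \<noteq> s" "f b = s" using bs by auto
    define V where "V = {x \<in> U. (x, b) \<in> ?E\<^sup>*}"
    define W where "W = U - V"
    have "(s, b) \<notin> ?E\<^sup>*"
      using b(2) by (auto elim: converse_rtranclE)
    then have sW: "s \<in> W" and sV: "s \<notin> V" using less.prems(2) by (auto simp: V_def W_def)
    have bV: "b \<in> V" using b by (simp add: V_def)
    have fV: "f x \<in> V" if "x \<in> V" and xb: "x \<noteq> b" for x
    proof -
      from that have "(x, b) \<in> ?E\<^sup>*" by (simp add: V_def)
      then obtain y where "(x, y) \<in> ?E" "(y, b) \<in> ?E\<^sup>*" using xb by (metis converse_rtranclE)
      then show ?thesis using less.prems(4) by (auto simp: V_def)
    qed
    have fW: "f x \<in> W" if "x \<in> W" "x \<noteq> s" for x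
    proof -
      have "(x, f x) \<in> ?E" "f x \<in> U" using that less.prems(4) by (auto simp: W_def)
      then show ?thesis using that by (auto simp: W_def V_def intro: converse_rtrancl_into_rtrancl)
    qed
    have reachV: "(x, b) \<in> (graph f (V - {b}))\<^sup>*" if "x \<in> V" for x
    proof -
      have "(x, b) \<in> ?E\<^sup>*" using that by (simp add: V_def)
      then show ?thesis using that
      proof (induction rule: converse_rtrancl_induct)
        case (step y z)
        show ?case
        proof (cases "y = b")
          case False
          then have "(y, z) \<in> graph f (V - {b})" "z \<in> V" using step fV by auto
          then show ?thesis using step.IH by (meson converse_rtrancl_into_rtrancl)
        qed simp
      qed simp
    qed
    have reachW: "(x, s) \<in> (graph f (W - {s}))\<^sup>*" if "x \<in> W" for x
    proof -
      have "(x, s) \<in> ?E\<^sup>*" using that less.prems(5) by (simp add: W_def)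
      then show ?thesis using that
      proof (induction rule: converse_rtrancl_induct)
        case (step y z)
        then have "(y, z) \<in> graph f (W - {s})" "z \<in> W" using fW by auto
        then show ?case using step.IH by (meson converse_rtrancl_into_rtrancl)
      qed simp
    qed
    have fin: "finite V" "finite W" and UVW: "W \<union> V = U" "W \<inter> V = {}"
      using less.prems(1) by (auto simp: V_def W_def)
    have cardV: "card V < card U" using less.prems(1) UVW sW sV
      by (intro psubset_card_mono) auto
    have cardW: "card W < card U" using less.prems(1) UVW bV
      by (intro psubset_card_mono) auto
    \<comment> \<open>The induction hypothesis wants a mark in either part. Where the true mark is
      absent, the root of the part serves as a dummy: \<open>b\<close> here if \<open>r = s\<close>,
      and \<open>s\<close> in the rest otherwise.\<close>
    define r' where "r' = (if r = s then b else r)"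
    have r'V: "r' \<in> V" using b0 bV x0 less.prems(3) by (auto simp: r'_def V_def)
    \<comment> \<open>The renamings erase the root slot of the subtree, since \<open>b\<close> now
      receives its outgoing edge, and the mark of whichever part carries the dummy.\<close>
    define g where "g = (if r = s then id(0 := 2, 1 := 2) else id(0 := (2::nat)))"
    define g' where "g' = (if r = s then id else id(1 := (2::nat)))"
    have edges: "?E = glue_edges (2, 2, 0, 0) (graph f (W - {s})) (slots {s} {s} P W)
        (graph f (V - {b})) (slots {b} {r'} P V)"
      using b(3) bV sV sW UVW by (auto simp: glue_edges_def)
    have sets: "slots {s} {r} P U = glue_sets g' g (slots {s} {s} P W) (slots {b} {r'} P V)"
    proof
      fix i
      show "slots {s} {r} P U i = glue_sets g' g (slots {s} {s} P W) (slots {b} {r'} P V) i"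
        unfolding glue_sets_def UVW(1)[symmetric]
        by (auto simp: g_def g'_def r'_def slots_def)
    qed
    have "tp k m (W \<union> V) (glue_edges (2, 2, 0, 0) (graph f (W - {s})) (slots {s} {s} P W)
        (graph f (V - {b})) (slots {b} {r'} P V))
        (glue_sets g' g (slots {s} {s} P W) (slots {b} {r'} P V)) \<in> realizable k m"
    proof (rule realizable_glue)
      show "tp k m W (graph f (W - {s})) (slots {s} {s} P W) \<in> realizable k m"
        using fW reachW sW by (intro less.hyps[OF cardW fin(2)]) auto
      show "tp k m V (graph f (V - {b})) (slots {b} {r'} P V) \<in> realizable k m"
        using fV reachV bV r'V by (intro less.hyps[OF cardV fin(1)]) auto
      show "rel_struct W (graph f (W - {s})) (slots {s} {s} P W)"
        using fW sW fin by (intro rel_struct_slots) auto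
      show "rel_struct V (graph f (V - {b})) (slots {b} {r'} P V)"
        using fV bV r'V fin by (intro rel_struct_slots) auto
      show "index_map m g'" "index_map m g"
        using index_map_clear[OF m] by (simp_all add: g_def g'_def)
    qed (use m UVW in auto)
    then show ?thesis unfolding edges sets UVW(1) .
  qed
qed

text \<open>Without a cycle the converse of the finite graph would be well-founded, and a minimal
  node for it would have no successor in \<open>U\<close>.\<close>

lemma finite_function_cycle:
  assumes "finite U" "U \<noteq> {}" "f ` U \<subseteq> U"
  obtains s where "s \<in> U" "(s, s) \<in> (graph f U)\<^sup>+"
proof -
  have "\<not> acyclic (graph f U)"
  proof
    assume "acyclic (graph f U)"
    moreover have "finite (graph f U)" using assms(1) by (simp add: graph_def)
    ultimately have "wf ((graph f U)\<inverse>)" by (simp add: finite_acyclic_wf_converse)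
    moreover obtain x where "x \<in> U" using assms(2) by blast
    ultimately obtain z where "z \<in> U" "\<forall>y. (y, z) \<in> (graph f U)\<inverse> \<longrightarrow> y \<notin> U"
      unfolding wf_eq_minimal by metis
    then show False using assms(3) by auto
  qed
  then obtain s where s: "(s, s) \<in> (graph f U)\<^sup>+" by (auto simp: acyclic_def)
  then have "s \<in> U" by (meson tranclD graph_iff)
  with s show thesis by (rule that[rotated])
qed

text \<open>Without the edge out of \<open>s\<close> this is a tree with root \<open>s\<close>.
  Marking \<open>f s\<close> while building the tree makes it possible to add that edge last; this
  is what the marked node of \<open>realizable_tree\<close> is for. The second part is
  empty.\<close>

lemma realizable_cycle:
  fixes V :: "nat set"
  assumes m: "3 \<le> m" and V: "finite V" "s \<in> V" "f ` V \<subseteq> V"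
    and reach: "\<forall>x\<in>V. (x, s) \<in> (graph f (V - {s}))\<^sup>*"
  shows "tp k m V (graph f V) (slots {} {} P V) \<in> realizable k m"
proof -
  have edges: "graph f V = glue_edges (0, 1, 2, 2) (graph f (V - {s})) (slots {s} {f s} P V)
      {} (slots {} {} P {})"
    using V by (auto simp: glue_edges_def)
  have sets: "slots {} {} P V = glue_sets (id(0 := 2, 1 := 2)) id (slots {s} {f s} P V) (slots {} {} P {})"
    by (rule ext) (auto simp: glue_sets_def slots_def)
  have "tp k m (V \<union> {}) (glue_edges (0, 1, 2, 2) (graph f (V - {s})) (slots {s} {f s} P V) {} (slots {} {} P {}))
      (glue_sets (id(0 := 2, 1 := 2)) id (slots {s} {f s} P V) (slots {} {} P {})) \<in> realizable k m"
  proof (rule realizable_glue)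
    show "tp k m V (graph f (V - {s})) (slots {s} {f s} P V) \<in> realizable k m"
      using V reach by (intro realizable_tree[OF m]) auto
    show "tp k m {} {} (slots {} {} P {}) \<in> realizable k m"
      by (rule realizable_single[of _ 0]) (auto simp: slots_def)
    show "rel_struct V (graph f (V - {s})) (slots {s} {f s} P V)"
      using V by (intro rel_struct_slots) auto
    show "rel_struct {} {} (slots {} {} P {})" by (simp add: rel_struct_def slots_def)
  qed (use m index_map_clear[OF m] in auto)
  then show ?thesis unfolding edges sets by simp
qed

text \<open>The nodes that reach a given node \<open>s\<close> on a cycle form a union-free piece:
  they are closed under \<open>f\<close> because \<open>s\<close> reaches itself, and so is their
  complement. The graph is the disjoint union of the two.\<close>

lemma realizable_function:
  fixes U :: "nat set"
  assumes m: "3 \<le> m"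
  shows "finite U \<Longrightarrow> f ` U \<subseteq> U \<Longrightarrow> tp k m U (graph f U) (slots {} {} P U) \<in> realizable k m"
proof (induction "card U" arbitrary: U rule: less_induct)
  case less
  show ?case
  proof (cases "U = {}")
    case True
    then show ?thesis by (auto simp: graph_def slots_def intro!: realizable_single[of _ 0] split: if_splits)
  next
    case False
    then obtain s where s: "s \<in> U" and cyc: "(s, s) \<in> (graph f U)\<^sup>+"
      using finite_function_cycle less.prems by metis
    define V where "V = {x \<in> U. (x, s) \<in> (graph f U)\<^sup>*}"
    define W where "W = U - V"
    have sV: "s \<in> V" using s by (simp add: V_def)
    obtain y where "(s, y) \<in> graph f U" "(y, s) \<in> (graph f U)\<^sup>*" using cyc by (meson tranclD)
    then have fs: "f s \<in> V" using less.prems by (auto simp: V_def)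
    have fV: "f x \<in> V" if "x \<in> V" for x
    proof (cases "x = s")
      case False
      from that have "(x, s) \<in> (graph f U)\<^sup>*" by (simp add: V_def)
      then obtain y where "(x, y) \<in> graph f U" "(y, s) \<in> (graph f U)\<^sup>*" using False by (metis converse_rtranclE)
      then show ?thesis using less.prems by (auto simp: V_def)
    qed (use fs in simp)
    have fW: "f x \<in> W" if "x \<in> W" for x
    proof -
      have "(x, f x) \<in> graph f U" "f x \<in> U" using that less.prems(2) by (auto simp: W_def)
      then show ?thesis using that by (auto simp: W_def V_def intro: converse_rtrancl_into_rtrancl)
    qed
    have reach: "(x, s) \<in> (graph f (V - {s}))\<^sup>*" if "x \<in> V" for x
    proof -
      have "(x, s) \<in> (graph f U)\<^sup>*" using that by (simp add: V_def)
      then show ?thesis using that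
      proof (induction rule: converse_rtrancl_induct)
        case (step y z)
        show ?case
        proof (cases "y = s")
          case False
          then have "(y, z) \<in> graph f (V - {s})" "z \<in> V" using step fV by auto
          then show ?thesis using step.IH by (meson converse_rtrancl_into_rtrancl)
        qed simp
      qed simp
    qed
    have fin: "finite V" "finite W" and UVW: "W \<union> V = U" "W \<inter> V = {}"
      using less.prems(1) by (auto simp: V_def W_def)
    have cardW: "card W < card U" using less.prems(1) UVW sV
      by (intro psubset_card_mono) auto
    have edges: "graph f U = glue_edges (2, 2, 2, 2) (graph f W) (slots {} {} P W) (graph f V) (slots {} {} P V)"
      unfolding UVW(1)[symmetric] by (auto simp: glue_edges_def)
    have sets: "slots {} {} P U = glue_sets id id (slots {} {} P W) (slots {} {} P V)"
      unfolding UVW(1)[symmetric] by (rule ext) (auto simp: glue_sets_def slots_def)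
    have "tp k m (W \<union> V) (glue_edges (2, 2, 2, 2) (graph f W) (slots {} {} P W) (graph f V) (slots {} {} P V))
        (glue_sets id id (slots {} {} P W) (slots {} {} P V)) \<in> realizable k m"
    proof (rule realizable_glue)
      show "tp k m W (graph f W) (slots {} {} P W) \<in> realizable k m"
        using fW by (intro less.hyps[OF cardW fin(2)]) auto
      show "tp k m V (graph f V) (slots {} {} P V) \<in> realizable k m"
        using fV reach sV fin by (intro realizable_cycle[OF m]) auto
      show "rel_struct W (graph f W) (slots {} {} P W)" "rel_struct V (graph f V) (slots {} {} P V)"
        using fW fV fin by (auto intro!: rel_struct_slots)
    qed (use m UVW index_map_clear[OF m] in auto)
    then show ?thesis unfolding edges sets UVW(1) .
  qed
qed

text \<open>The number \<open>n\<close> of possible types bounds the stage at which a type appears,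
  and the exponent 2 to the \<open>n\<close> comes from doubling at every stage. The edges obtained
  form just some relation at this point.\<close>

lemma small_realization:
  fixes U :: "nat set" and k m :: nat
  defines "n \<equiv> tower k (Suc (prod_encode (2, prod_encode (m + k, m + k))))"
  assumes "3 \<le> m" "finite U" "f ` U \<subseteq> U"
  obtains U' :: "nat set" and E A where "rel_struct U' E A" "U' \<subseteq> {..<2 ^ n}"
    "tp k m U' E A = tp k m U (graph f U) (slots {} {} P U)"
proof -
  have "tp k m U (graph f U) (slots {} {} P U) \<in> tp_chain k m n"
    unfolding n_def tp_chain_fixpoint realizable_def[symmetric] by (rule realizable_function[OF assms(2-)])
  from tp_chain_small[OF this] that show thesis by blast
qed

section \<open>Types determine satisfaction\<close>

lemma tp_eq_atoms:
  assumes "finite U" "finite U'" "tp k m U E A = tp k m U' E' A'" "i < m" "j < m"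
  shows "A i \<inter> A j = {} \<longleftrightarrow> A' i \<inter> A' j = {}"
    and "(A i \<times> A j) \<inter> E = {} \<longleftrightarrow> (A' i \<times> A' j) \<inter> E' = {}"
    and "(\<exists>a. A i \<subseteq> {a}) \<longleftrightarrow> (\<exists>a. A' i \<subseteq> {a})"
proof -
  have "tp 0 m U E A = tp 0 m U' E' A'" by (rule tp_le[OF assms(1-3)]) simp
  from this[unfolded tp_0_eq_iff] assms(4,5) show "A i \<inter> A j = {} \<longleftrightarrow> A' i \<inter> A' j = {}"
    and "(A i \<times> A j) \<inter> E = {} \<longleftrightarrow> (A' i \<times> A' j) \<inter> E' = {}"
    and "(\<exists>a. A i \<subseteq> {a}) \<longleftrightarrow> (\<exists>a. A' i \<subseteq> {a})"
    by simp_all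
qed

lemma tp_eq_singleton:
  assumes "finite U" "finite U'" "tp k m U E A = tp k m U' E' A'" "i < m" "A i = {a}"
  obtains a' where "A' i = {a'}"
proof -
  have "A' i \<noteq> {}" using tp_eq_atoms(1)[OF assms(1-4) assms(4)] assms(5) by simp
  moreover have "\<exists>a. A' i \<subseteq> {a}" using tp_eq_atoms(3)[OF assms(1-4) assms(4)] assms(5) by simp
  ultimately show thesis using that by (auto simp: subset_singleton_iff)
qed

lemma tp_eq_extend:
  assumes "finite U" "finite U'" "tp (Suc k) m U E A = tp (Suc k) m U' E' A'" "X \<subseteq> U"
  obtains X' where "X' \<subseteq> U'" "tp k (Suc m) U E (A(m := X)) = tp k (Suc m) U' E' (A'(m := X'))"
proof -
  have "\<forall>X\<subseteq>U. \<exists>X'\<subseteq>U'. tp k (Suc m) U E (A(m := X)) = tp k (Suc m) U' E' (A'(m := X'))"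
    using assms(3) unfolding tp_Suc_eq_iff[OF assms(1,2)] by (rule conjunct1)
  from this[rule_format, OF assms(4)] show thesis by (elim exE conjE) (rule that)
qed

text \<open>A singleton can only be answered by a singleton, since the atoms tell, so element moves
  are special set moves.\<close>

lemma tp_eq_extend_point:
  assumes "finite U" "finite U'" "tp (Suc k) m U E A = tp (Suc k) m U' E' A'" "a \<in> U"
  obtains a' where "a' \<in> U'" "tp k (Suc m) U E (A(m := {a})) = tp k (Suc m) U' E' (A'(m := {a'}))"
proof -
  from assms(4) have "{a} \<subseteq> U" by simp
  from tp_eq_extend[OF assms(1-3) this] obtain X' where
    X': "X' \<subseteq> U'" "tp k (Suc m) U E (A(m := {a})) = tp k (Suc m) U' E' (A'(m := X'))" .
  from tp_eq_singleton[OF assms(1,2) X'(2) lessI fun_upd_same] obtain a' where "X' = {a'}" by auto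
  with X' show thesis by (intro that[of a']) auto
qed

text \<open>Three rounds suffice. The node \<open>x\<close> is answered by some \<open>a\<close>,
  then \<open>f a\<close> by a successor \<open>y\<close> of \<open>x\<close>. A further successor
  \<open>z\<close> is answered by a successor \<open>b\<close> of \<open>a\<close>; then
  \<open>b = f a\<close>, and the atoms give \<open>z = y\<close>.\<close>

lemma tp_eq_functional:
  assumes U: "finite U" "finite U'" "f ` U \<subseteq> U" "E \<subseteq> U' \<times> U'"
    and eq: "tp 3 m U (graph f U) A = tp 3 m U' E A'" and x: "x \<in> U'"
  shows "\<exists>!y. (x, y) \<in> E"
proof -
  have "tp (Suc 2) m U' E A' = tp (Suc 2) m U (graph f U) A" using eq by (simp add: numeral_3_eq_3 numeral_2_eq_2)
  from tp_eq_extend_point[OF U(2,1) this x] obtain a where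
    a: "a \<in> U" "tp 2 (Suc m) U' E (A'(m := {x})) = tp 2 (Suc m) U (graph f U) (A(m := {a}))" .
  have "tp (Suc 1) (Suc m) U (graph f U) (A(m := {a})) = tp (Suc 1) (Suc m) U' E (A'(m := {x}))"
    using a(2) by (simp add: numeral_2_eq_2)
  moreover have "f a \<in> U" using a U by blast
  ultimately obtain y where y: "y \<in> U'"
    "tp 1 (Suc (Suc m)) U (graph f U) (A(m := {a}, Suc m := {f a})) =
      tp 1 (Suc (Suc m)) U' E (A'(m := {x}, Suc m := {y}))"
    by (rule tp_eq_extend_point[OF U(1,2)])
  have xy: "(x, y) \<in> E"
    using tp_eq_atoms(2)[OF U(1,2) y(2), of m "Suc m"] a(1) by auto
  show ?thesis
  proof (rule ex1I[of "\<lambda>y. (x, y) \<in> E" y, OF xy])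
    fix z assume xz: "(x, z) \<in> E"
    then have z: "z \<in> U'" using U(4) by blast
    have "tp (Suc 0) (Suc (Suc m)) U' E (A'(m := {x}, Suc m := {y})) =
        tp (Suc 0) (Suc (Suc m)) U (graph f U) (A(m := {a}, Suc m := {f a}))"
      using y(2) by (simp only: One_nat_def)
    from this z obtain b where b: "b \<in> U"
      "tp 0 (Suc (Suc (Suc m))) U' E (A'(m := {x}, Suc m := {y}, Suc (Suc m) := {z})) =
       tp 0 (Suc (Suc (Suc m))) U (graph f U) (A(m := {a}, Suc m := {f a}, Suc (Suc m) := {b}))"
      by (rule tp_eq_extend_point[OF U(2,1)])
    have "(a, b) \<in> graph f U"
      using tp_eq_atoms(2)[OF U(2,1) b(2), of m "Suc (Suc m)"] xz by auto
    then show "z = y"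
      using tp_eq_atoms(1)[OF U(2,1) b(2), of "Suc m" "Suc (Suc m)"] by auto
  qed
qed

section \<open>Quantifier rank and the transfer of satisfaction\<close>

primrec tm_depth :: "tm \<Rightarrow> nat" where
  "tm_depth (Var x) = 0"
| "tm_depth (App t) = Suc (tm_depth t)"

text \<open>An application of the function symbol costs a round, because its value enters the game
  as a new singleton. In an equation the depths add up: the two terms are evaluated one after the
  other in the same game.\<close>

primrec fm_rank :: "fm \<Rightarrow> nat" where
  "fm_rank (Eq t u) = tm_depth t + tm_depth u"
| "fm_rank (Pred i t) = tm_depth t"
| "fm_rank (Mem t X) = tm_depth t"
| "fm_rank (Neg \<phi>) = fm_rank \<phi>"
| "fm_rank (Conj \<phi> \<psi>) = max (fm_rank \<phi>) (fm_rank \<psi>)"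
| "fm_rank (Disj \<phi> \<psi>) = max (fm_rank \<phi>) (fm_rank \<psi>)"
| "fm_rank (Imp \<phi> \<psi>) = max (fm_rank \<phi>) (fm_rank \<psi>)"
| "fm_rank (Ex x \<phi>) = Suc (fm_rank \<phi>)"
| "fm_rank (All x \<phi>) = Suc (fm_rank \<phi>)"
| "fm_rank (ExSet X \<phi>) = Suc (fm_rank \<phi>)"
| "fm_rank (AllSet X \<phi>) = Suc (fm_rank \<phi>)"

primrec fm_preds :: "fm \<Rightarrow> nat set" where
  "fm_preds (Eq t u) = {}"
| "fm_preds (Pred i t) = {i}"
| "fm_preds (Mem t X) = {}"
| "fm_preds (Neg \<phi>) = fm_preds \<phi>"
| "fm_preds (Conj \<phi> \<psi>) = fm_preds \<phi> \<union> fm_preds \<psi>"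
| "fm_preds (Disj \<phi> \<psi>) = fm_preds \<phi> \<union> fm_preds \<psi>"
| "fm_preds (Imp \<phi> \<psi>) = fm_preds \<phi> \<union> fm_preds \<psi>"
| "fm_preds (Ex x \<phi>) = fm_preds \<phi>"
| "fm_preds (All x \<phi>) = fm_preds \<phi>"
| "fm_preds (ExSet X \<phi>) = fm_preds \<phi>"
| "fm_preds (AllSet X \<phi>) = fm_preds \<phi>"

abbreviation struct_tp :: "nat \<Rightarrow> nat \<Rightarrow> 'a struct \<Rightarrow> (nat \<Rightarrow> 'a set) \<Rightarrow> nat" where
  "struct_tp k m M A \<equiv> tp k m (universe M) (graph (func M) (universe M)) A"

text \<open>The answer to \<open>{func M a}\<close> must be a successor of \<open>a'\<close>, and
  the graph of \<open>N\<close> offers only one.\<close>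

lemma struct_tp_func:
  assumes M: "is_struct M" "is_struct N" and fin: "finite (universe M)" "finite (universe N)"
    and eq: "struct_tp (Suc k) m M A = struct_tp (Suc k) m N A'"
    and j: "j < m" "A j = {a}" "A' j = {a'}" "a \<in> universe M"
  shows "struct_tp k (Suc m) M (A(m := {func M a})) = struct_tp k (Suc m) N (A'(m := {func N a'}))"
proof -
  have "func M a \<in> universe M" using M j by (simp add: is_struct_def)
  from tp_eq_extend_point[OF fin eq this] obtain b where
    b: "b \<in> universe N" "struct_tp k (Suc m) M (A(m := {func M a})) = struct_tp k (Suc m) N (A'(m := {b}))" .
  have "(a', b) \<in> graph (func N) (universe N)"
    using tp_eq_atoms(2)[OF fin b(2), of j m] j by auto
  then show ?thesis using b by simp
qed

text \<open>One round per application, by \<open>struct_tp_func\<close>. Sets named below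
  \<open>m\<close> are kept, so that predicates, set variables and a second term can still be read
  afterwards.\<close>

lemma struct_tp_tm:
  assumes M: "is_struct M" "is_struct N" and fin: "finite (universe M)" "finite (universe N)"
    and eq: "struct_tp (k + tm_depth t) m M A = struct_tp (k + tm_depth t) m N A'"
    and v: "\<forall>x\<in>tm_vars t. v x < m \<and> A (v x) = {e x} \<and> A' (v x) = {e' x} \<and> e x \<in> universe M"
  obtains m' B B' j where "m \<le> m'" "\<forall>i<m. B i = A i \<and> B' i = A' i"
    "struct_tp k m' M B = struct_tp k m' N B'"
    "j < m'" "B j = {tm_val M e t}" "B' j = {tm_val N e' t}" "tm_val M e t \<in> universe M"
  using eq v
proof (induction t arbitrary: k thesis)
  case (Var x)
  then show ?case by (intro Var(1)[of m A A' "v x"]) auto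
next
  case (App t)
  have "struct_tp (Suc k + tm_depth t) m M A = struct_tp (Suc k + tm_depth t) m N A'"
    using App.prems(2) by (simp del: tp.simps)
  moreover have "\<forall>x\<in>tm_vars t. v x < m \<and> A (v x) = {e x} \<and> A' (v x) = {e' x} \<and> e x \<in> universe M"
    using App.prems(3) by simp
  ultimately obtain m' B B' j where B: "m \<le> m'" "\<forall>i<m. B i = A i \<and> B' i = A' i"
    "struct_tp (Suc k) m' M B = struct_tp (Suc k) m' N B'"
    "j < m'" "B j = {tm_val M e t}" "B' j = {tm_val N e' t}" "tm_val M e t \<in> universe M"
    by (rule App.IH[rotated])
  show ?case
    by (rule App.prems(1)[OF _ _ struct_tp_func[OF M fin B(3-7)], of m'])
      (use B M in \<open>auto simp: is_struct_def\<close>)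
qed

text \<open>\<open>v\<close>, \<open>w\<close> and \<open>p\<close> tell under which index the value
  of an element variable, set variable or predicate is named. A quantifier names its value
  \<open>m\<close> and redirects its variable there.\<close>

lemma sat_transfer:
  assumes M: "is_struct M" "is_struct N" and fin: "finite (universe M)" "finite (universe N)"
    and "struct_tp k m M A = struct_tp k m N A'" "fm_rank \<phi> \<le> k"
    and "\<forall>x\<in>free_vars \<phi>. v x < m \<and> A (v x) = {e x} \<and> A' (v x) = {e' x} \<and> e x \<in> universe M"
    and "\<forall>X\<in>free_set_vars \<phi>. w X < m \<and> A (w X) = s X \<and> A' (w X) = s' X"
    and "\<forall>i\<in>fm_preds \<phi>. p i < m \<and> A (p i) = preds M i \<and> A' (p i) = preds N i"
  shows "sat M e s \<phi> \<longleftrightarrow> sat N e' s' \<phi>"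
  using assms(5-)
proof (induction \<phi> arbitrary: k m A A' v w e e' s s')
  case (Eq t u)
  have "struct_tp (tm_depth u + tm_depth t) m M A = struct_tp (tm_depth u + tm_depth t) m N A'"
    using Eq(2) by (intro tp_le[OF fin Eq(1)]) simp
  moreover have "\<forall>x\<in>tm_vars t. v x < m \<and> A (v x) = {e x} \<and> A' (v x) = {e' x} \<and> e x \<in> universe M"
    using Eq(3) by simp
  ultimately obtain m' B B' j where B: "m \<le> m'" "\<forall>i<m. B i = A i \<and> B' i = A' i"
    "struct_tp (tm_depth u) m' M B = struct_tp (tm_depth u) m' N B'"
    "j < m'" "B j = {tm_val M e t}" "B' j = {tm_val N e' t}" "tm_val M e t \<in> universe M"
    by (rule struct_tp_tm[OF M fin])
  have "struct_tp (0 + tm_depth u) m' M B = struct_tp (0 + tm_depth u) m' N B'" using B(3) by simp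
  moreover have "\<forall>x\<in>tm_vars u. v x < m' \<and> B (v x) = {e x} \<and> B' (v x) = {e' x} \<and> e x \<in> universe M"
    using Eq(3) B(1,2) by (simp add: less_le_trans[OF _ B(1)])
  ultimately obtain m'' C C' j' where C: "m' \<le> m''" "\<forall>i<m'. C i = B i \<and> C' i = B' i"
    "struct_tp 0 m'' M C = struct_tp 0 m'' N C'"
    "j' < m''" "C j' = {tm_val M e u}" "C' j' = {tm_val N e' u}" "tm_val M e u \<in> universe M"
    by (rule struct_tp_tm[OF M fin])
  have "C j = {tm_val M e t}" "C' j = {tm_val N e' t}" "j < m''" using B C by auto
  then show ?case using tp_eq_atoms(1)[OF fin C(3), of j j'] C(4-6) by (simp add: eq_commute)
next
  case (Pred i t)
  have "struct_tp (0 + tm_depth t) m M A = struct_tp (0 + tm_depth t) m N A'"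
    using Pred(2) by (intro tp_le[OF fin Pred(1)]) simp
  moreover have "\<forall>x\<in>tm_vars t. v x < m \<and> A (v x) = {e x} \<and> A' (v x) = {e' x} \<and> e x \<in> universe M"
    using Pred(3) by simp
  ultimately obtain m' B B' j where B: "m \<le> m'" "\<forall>i<m. B i = A i \<and> B' i = A' i"
    "struct_tp 0 m' M B = struct_tp 0 m' N B'"
    "j < m'" "B j = {tm_val M e t}" "B' j = {tm_val N e' t}" "tm_val M e t \<in> universe M"
    by (rule struct_tp_tm[OF M fin])
  have "B (p i) = preds M i" "B' (p i) = preds N i" "p i < m'" using B(1,2) Pred(5) by auto
  then show ?case using tp_eq_atoms(1)[OF fin B(3), of j "p i"] B(4-6) by simp
next
  case (Mem t X)
  have "struct_tp (0 + tm_depth t) m M A = struct_tp (0 + tm_depth t) m N A'"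
    using Mem(2) by (intro tp_le[OF fin Mem(1)]) simp
  moreover have "\<forall>x\<in>tm_vars t. v x < m \<and> A (v x) = {e x} \<and> A' (v x) = {e' x} \<and> e x \<in> universe M"
    using Mem(3) by simp
  ultimately obtain m' B B' j where B: "m \<le> m'" "\<forall>i<m. B i = A i \<and> B' i = A' i"
    "struct_tp 0 m' M B = struct_tp 0 m' N B'"
    "j < m'" "B j = {tm_val M e t}" "B' j = {tm_val N e' t}" "tm_val M e t \<in> universe M"
    by (rule struct_tp_tm[OF M fin])
  have "B (w X) = s X" "B' (w X) = s' X" "w X < m'" using B(1,2) Mem(4) by auto
  then show ?case using tp_eq_atoms(1)[OF fin B(3), of j "w X"] B(4-6) by simp
next
  case (Neg \<phi>)
  have "sat M e s \<phi> = sat N e' s' \<phi>" by (rule Neg.IH[where v = v and w = w]) (use Neg.prems in \<open>auto simp del: tp.simps\<close>)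
  then show ?case by simp
next
  case (Conj \<phi> \<psi>)
  have "sat M e s \<phi> = sat N e' s' \<phi>" by (rule Conj.IH(1)[where v = v and w = w]) (use Conj.prems in \<open>auto simp del: tp.simps\<close>)
  moreover have "sat M e s \<psi> = sat N e' s' \<psi>" by (rule Conj.IH(2)[where v = v and w = w]) (use Conj.prems in \<open>auto simp del: tp.simps\<close>)
  ultimately show ?case by simp
next
  case (Disj \<phi> \<psi>)
  have "sat M e s \<phi> = sat N e' s' \<phi>" by (rule Disj.IH(1)[where v = v and w = w]) (use Disj.prems in \<open>auto simp del: tp.simps\<close>)
  moreover have "sat M e s \<psi> = sat N e' s' \<psi>" by (rule Disj.IH(2)[where v = v and w = w]) (use Disj.prems in \<open>auto simp del: tp.simps\<close>)
  ultimately show ?case by simp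
next
  case (Imp \<phi> \<psi>)
  have "sat M e s \<phi> = sat N e' s' \<phi>" by (rule Imp.IH(1)[where v = v and w = w]) (use Imp.prems in \<open>auto simp del: tp.simps\<close>)
  moreover have "sat M e s \<psi> = sat N e' s' \<psi>" by (rule Imp.IH(2)[where v = v and w = w]) (use Imp.prems in \<open>auto simp del: tp.simps\<close>)
  ultimately show ?case by simp
next
  case (Ex x \<phi>)
  from Ex.prems(2) obtain k' where k': "k = Suc k'" "fm_rank \<phi> \<le> k'" by (cases k) auto
  have *: "sat M (e(x := a)) s \<phi> = sat N (e'(x := a')) s' \<phi>"
    if "a \<in> universe M" "struct_tp k' (Suc m) M (A(m := {a})) = struct_tp k' (Suc m) N (A'(m := {a'}))" for a a'
    by (rule Ex.IH[OF that(2) k'(2), of "v(x := m)" _ _ w]) (use Ex.prems(3-) that(1) in \<open>auto simp: less_Suc_eq\<close>)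
  note eq = Ex.prems(1)[unfolded k'(1)]
  have "\<exists>a'\<in>universe N. sat M (e(x := a)) s \<phi> = sat N (e'(x := a')) s' \<phi>" if "a \<in> universe M" for a
    using tp_eq_extend_point[OF fin eq that] *[OF that] by metis
  moreover have "\<exists>a\<in>universe M. sat M (e(x := a)) s \<phi> = sat N (e'(x := a')) s' \<phi>" if "a' \<in> universe N" for a'
    using tp_eq_extend_point[OF fin(2,1) eq[symmetric] that] * by metis
  ultimately show ?case unfolding sat.simps by blast
next
  case (All x \<phi>)
  from All.prems(2) obtain k' where k': "k = Suc k'" "fm_rank \<phi> \<le> k'" by (cases k) auto
  have *: "sat M (e(x := a)) s \<phi> = sat N (e'(x := a')) s' \<phi>"
    if "a \<in> universe M" "struct_tp k' (Suc m) M (A(m := {a})) = struct_tp k' (Suc m) N (A'(m := {a'}))" for a a'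
    by (rule All.IH[OF that(2) k'(2), of "v(x := m)" _ _ w]) (use All.prems(3-) that(1) in \<open>auto simp: less_Suc_eq\<close>)
  note eq = All.prems(1)[unfolded k'(1)]
  have "\<exists>a'\<in>universe N. sat M (e(x := a)) s \<phi> = sat N (e'(x := a')) s' \<phi>" if "a \<in> universe M" for a
    using tp_eq_extend_point[OF fin eq that] *[OF that] by metis
  moreover have "\<exists>a\<in>universe M. sat M (e(x := a)) s \<phi> = sat N (e'(x := a')) s' \<phi>" if "a' \<in> universe N" for a'
    using tp_eq_extend_point[OF fin(2,1) eq[symmetric] that] * by metis
  ultimately show ?case unfolding sat.simps by blast
next
  case (ExSet X \<phi>)
  from ExSet.prems(2) obtain k' where k': "k = Suc k'" "fm_rank \<phi> \<le> k'" by (cases k) auto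
  have *: "sat M e (s(X := Z)) \<phi> = sat N e' (s'(X := Z')) \<phi>"
    if "struct_tp k' (Suc m) M (A(m := Z)) = struct_tp k' (Suc m) N (A'(m := Z'))" for Z Z'
    by (rule ExSet.IH[OF that k'(2), of v _ _ "w(X := m)"]) (use ExSet.prems(3-) in \<open>auto simp: less_Suc_eq\<close>)
  note eq = ExSet.prems(1)[unfolded k'(1)]
  have "\<exists>Z'\<subseteq>universe N. sat M e (s(X := Z)) \<phi> = sat N e' (s'(X := Z')) \<phi>" if "Z \<subseteq> universe M" for Z
    using tp_eq_extend[OF fin eq that] * by metis
  moreover have "\<exists>Z\<subseteq>universe M. sat M e (s(X := Z)) \<phi> = sat N e' (s'(X := Z')) \<phi>" if "Z' \<subseteq> universe N" for Z'
    using tp_eq_extend[OF fin(2,1) eq[symmetric] that] * by metis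
  ultimately show ?case unfolding sat.simps by metis
next
  case (AllSet X \<phi>)
  from AllSet.prems(2) obtain k' where k': "k = Suc k'" "fm_rank \<phi> \<le> k'" by (cases k) auto
  have *: "sat M e (s(X := Z)) \<phi> = sat N e' (s'(X := Z')) \<phi>"
    if "struct_tp k' (Suc m) M (A(m := Z)) = struct_tp k' (Suc m) N (A'(m := Z'))" for Z Z'
    by (rule AllSet.IH[OF that k'(2), of v _ _ "w(X := m)"]) (use AllSet.prems(3-) in \<open>auto simp: less_Suc_eq\<close>)
  note eq = AllSet.prems(1)[unfolded k'(1)]
  have "\<exists>Z'\<subseteq>universe N. sat M e (s(X := Z)) \<phi> = sat N e' (s'(X := Z')) \<phi>" if "Z \<subseteq> universe M" for Z
    using tp_eq_extend[OF fin eq that] * by metis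
  moreover have "\<exists>Z\<subseteq>universe M. sat M e (s(X := Z)) \<phi> = sat N e' (s'(X := Z')) \<phi>" if "Z' \<subseteq> universe N" for Z'
    using tp_eq_extend[OF fin(2,1) eq[symmetric] that] * by metis
  ultimately show ?case unfolding sat.simps by metis
qed

section \<open>The small model property\<close>

lemma add_le_prod_encode: "a + b \<le> prod_encode (a, b)"
proof -
  have "n \<le> triangle n" for n by (induction n) simp_all
  from this[of "a + b"] show ?thesis by (simp add: prod_encode_def)
qed

text \<open>Strictness can fail at tag 0, for instance \<open>prod_encode (0, 1) = 1\<close>;
  variables and equations, which carry that tag, are handled with
  \<open>add_le_prod_encode\<close>.\<close>

lemma less_prod_encode: "0 < a \<Longrightarrow> b < prod_encode (a, b)"
  using add_le_prod_encode[of a b] by simp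

lemma code_le_arguments:
  assumes "0 < a" "prod_encode (a, prod_encode (b, c)) \<le> n"
  shows "b < n" "c < n"
  using less_prod_encode[OF assms(1), of "prod_encode (b, c)"] add_le_prod_encode[of b c] assms(2)
  by linarith+

lemma tm_depth_le_code: "tm_depth t \<le> tm_code t"
proof (induction t)
  case (App t)
  then show ?case using less_prod_encode[of 1 "tm_code t"] by simp
qed simp

text \<open>The algorithm sees only the code, so the code itself serves as the bound on rank and,
  below, on predicate names.\<close>

lemma fm_rank_le_code: "fm_rank \<phi> \<le> fm_code \<phi>"
proof (induction \<phi>)
  case (Eq t u)
  have "tm_depth t + tm_depth u \<le> prod_encode (tm_code t, tm_code u)"
    using add_le_prod_encode[of "tm_code t" "tm_code u"] tm_depth_le_code[of t] tm_depth_le_code[of u] by linarith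
  also have "\<dots> \<le> fm_code (Eq t u)" by (simp add: le_prod_encode_2)
  finally show ?case by simp
next
  case (Pred i t)
  show ?case using code_le_arguments(2)[of 1 i "tm_code t", OF _ order_refl] tm_depth_le_code[of t] by simp
next
  case (Mem t X)
  show ?case using code_le_arguments(1)[of 2 "tm_code t" X, OF _ order_refl] tm_depth_le_code[of t] by simp
next
  case (Neg \<phi>)
  then show ?case using less_prod_encode[of 3 "fm_code \<phi>"] by simp
next
  case (Conj \<phi> \<psi>)
  then show ?case using code_le_arguments[of 4 "fm_code \<phi>" "fm_code \<psi>", OF _ order_refl] by simp
next
  case (Disj \<phi> \<psi>)
  then show ?case using code_le_arguments[of 5 "fm_code \<phi>" "fm_code \<psi>", OF _ order_refl] by simp
next
  case (Imp \<phi> \<psi>)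
  then show ?case using code_le_arguments[of 6 "fm_code \<phi>" "fm_code \<psi>", OF _ order_refl] by simp
next
  case (Ex x \<phi>)
  then show ?case using code_le_arguments(2)[of 7 x "fm_code \<phi>", OF _ order_refl] by simp
next
  case (All x \<phi>)
  then show ?case using code_le_arguments(2)[of 8 x "fm_code \<phi>", OF _ order_refl] by simp
next
  case (ExSet x \<phi>)
  then show ?case using code_le_arguments(2)[of 9 x "fm_code \<phi>", OF _ order_refl] by simp
next
  case (AllSet x \<phi>)
  then show ?case using code_le_arguments(2)[of 10 x "fm_code \<phi>", OF _ order_refl] by simp
qed

lemma fm_preds_le_code: "i \<in> fm_preds \<phi> \<Longrightarrow> i \<le> fm_code \<phi>"
proof (induction \<phi>)
  case (Pred j t)
  then show ?case using code_le_arguments(1)[of 1 j "tm_code t", OF _ order_refl] by simp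
next
  case (Neg \<phi>)
  then show ?case using less_prod_encode[of 3 "fm_code \<phi>"] by simp
next
  case (Conj \<phi> \<psi>)
  then show ?case using code_le_arguments[of 4 "fm_code \<phi>" "fm_code \<psi>", OF _ order_refl] by auto
next
  case (Disj \<phi> \<psi>)
  then show ?case using code_le_arguments[of 5 "fm_code \<phi>" "fm_code \<psi>", OF _ order_refl] by auto
next
  case (Imp \<phi> \<psi>)
  then show ?case using code_le_arguments[of 6 "fm_code \<phi>" "fm_code \<psi>", OF _ order_refl] by auto
next
  case (Ex x \<phi>)
  then show ?case using code_le_arguments(2)[of 7 x "fm_code \<phi>", OF _ order_refl] by simp
next
  case (All x \<phi>)
  then show ?case using code_le_arguments(2)[of 8 x "fm_code \<phi>", OF _ order_refl] by simp
next
  case (ExSet x \<phi>)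
  then show ?case using code_le_arguments(2)[of 9 x "fm_code \<phi>", OF _ order_refl] by simp
next
  case (AllSet x \<phi>)
  then show ?case using code_le_arguments(2)[of 10 x "fm_code \<phi>", OF _ order_refl] by simp
qed simp_all

text \<open>\<open>sat_transfer\<close> from \<open>M\<close> to itself: in a sentence no variable
  has to be named, so the assignments on the two sides may differ.\<close>

lemma sat_sentence_cong:
  assumes "sentence \<phi>" "is_struct M" "finite (universe M)"
  shows "sat M e s \<phi> \<longleftrightarrow> sat M e' s' \<phi>"
proof -
  let ?m = "Suc (fm_code \<phi>)"
  show ?thesis
    by (rule sat_transfer[OF assms(2,2,3,3) refl order_refl, of _ id ?m "preds M" _ _ id _ _ id])
      (use assms(1) in \<open>simp_all add: sentence_def less_Suc_eq_le fm_preds_le_code\<close>)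
qed

text \<open>Rank \<open>c + 3\<close> covers the formula, of rank at most \<open>c\<close>, and the
  three rounds of \<open>tp_eq_functional\<close>. The \<open>c + 4\<close> named sets are slots 0
  to 2 and predicates 0 to \<open>c\<close>. The outer power is the doubling per gluing
  stage.\<close>

definition model_bound :: "nat \<Rightarrow> nat" where
  "model_bound c = 2 ^ tower (c + 3) (Suc (prod_encode (2, prod_encode ((c + 4) + (c + 3), (c + 4) + (c + 3)))))"

theorem small_model:
  assumes "sentence \<phi>" "has_finite_model \<phi>"
  obtains M :: "nat struct" where "is_struct M" "universe M \<subseteq> {..<model_bound (fm_code \<phi>)}" "models M \<phi>"
proof -
  let ?c = "fm_code \<phi>"
  from assms(2) obtain M :: "nat struct" where M: "is_struct M" "finite (universe M)" "models M \<phi>"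
    by (auto simp: has_finite_model_def)
  \<comment> \<open>Predicate names move up by 3, past the slots reserved for gluing.\<close>
  define P where "P i = preds M (i - 3)" for i
  have fM: "func M ` universe M \<subseteq> universe M" using M(1) by (auto simp: is_struct_def)
  have m3: "3 \<le> ?c + 4" by simp
  obtain U E A where N: "rel_struct U E A" "U \<subseteq> {..<model_bound ?c}"
    "tp (?c + 3) (?c + 4) U E A = struct_tp (?c + 3) (?c + 4) M (slots {} {} P (universe M))"
    unfolding model_bound_def by (rule small_realization[OF m3 M(2) fM])
  note fin = M(2) N(1)[unfolded rel_struct_def, THEN conjunct1]
  have E: "E \<subseteq> U \<times> U" and A: "A i \<subseteq> U" for i using N(1) by (auto simp: rel_struct_def)
  have "tp 3 (?c + 4) (universe M) (graph (func M) (universe M)) (slots {} {} P (universe M)) = tp 3 (?c + 4) U E A"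
    by (rule tp_le[OF fin N(3)[symmetric]]) simp
  from tp_eq_functional[OF fin fM E this]
  have ex1: "\<exists>!y. (x, y) \<in> E" if "x \<in> U" for x using that .
  define f where "f x = (THE y. (x, y) \<in> E)" for x
  have f: "(x, y) \<in> E \<longleftrightarrow> y = f x" if "x \<in> U" for x y
    using theI'[OF ex1[OF that]] ex1[OF that] unfolding f_def by blast
  have EG: "E = graph f U"
  proof (rule set_eqI, clarify)
    show "(x, y) \<in> E \<longleftrightarrow> (x, y) \<in> graph f U" for x y
      using f[of x y] E by (cases "x \<in> U") auto
  qed
  define N' :: "nat struct" where "N' = \<lparr>universe = U, func = f, preds = (\<lambda>i. A (i + 3))\<rparr>"
  have eq: "struct_tp (Suc (?c + 2)) (?c + 4) M (slots {} {} P (universe M)) = struct_tp (Suc (?c + 2)) (?c + 4) N' A"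
    using N(3) by (simp add: N'_def EG numeral_3_eq_3 numeral_2_eq_2 del: tp.simps)
  \<comment> \<open>Types admit the empty universe; one more round transfers nonemptiness.\<close>
  obtain a0 where a0: "a0 \<in> universe M" using M(1) by (auto simp: is_struct_def)
  from tp_eq_extend_point[OF fin(1) _ eq a0] fin(2) obtain b0 where b0: "b0 \<in> U"
    by (auto simp: N'_def)
  have N': "is_struct N'" 
    unfolding is_struct_def N'_def using b0 A E by (auto simp: f[symmetric] dest: f[THEN iffD2, OF _ refl])
  have "sat N' e' s' \<phi>" for e' s'
  proof -
    have "sat M (\<lambda>_. a0) (\<lambda>_. {}) \<phi>" using M(3) a0 by (simp add: models_def)
    moreover have "sat M (\<lambda>_. a0) (\<lambda>_. {}) \<phi> \<longleftrightarrow> sat N' e' s' \<phi>"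
    proof (rule sat_transfer[OF M(1) N' fin(1) _ eq])
      show "fm_rank \<phi> \<le> Suc (?c + 2)" using fm_rank_le_code[of \<phi>] by simp
      show "\<forall>i\<in>fm_preds \<phi>. (i + 3) < ?c + 4 \<and> slots {} {} P (universe M) (i + 3) = preds M i \<and> A (i + 3) = preds N' i"
        using fm_preds_le_code M(1) by (auto simp: slots_def P_def N'_def is_struct_def less_Suc_eq_le)
    qed (use assms(1) fin in \<open>simp_all add: sentence_def N'_def\<close>)
    ultimately show ?thesis by simp
  qed
  then have "models N' \<phi>" by (simp add: models_def)
  with N' N(2) show thesis by (intro that[of N']) (simp_all add: N'_def)
qed

section \<open>A calculus of computable functions\<close>

text \<open>The arguments of an \<open>n\<close>-ary function are the first \<open>n\<close> values of an environment, so that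
  entering the scope of a bounded quantifier shifts the environment.\<close>

definition computable :: "nat \<Rightarrow> ((nat \<Rightarrow> nat) \<Rightarrow> nat) \<Rightarrow> bool" where
  "computable n F \<longleftrightarrow> (\<exists>p. \<forall>v. computes p (map v [0..<n]) (F v))"

abbreviation decidable :: "nat \<Rightarrow> ((nat \<Rightarrow> nat) \<Rightarrow> bool) \<Rightarrow> bool" where
  "decidable n P \<equiv> computable n (\<lambda>v. of_bool (P v))"

lemma computable_var: "i < n \<Longrightarrow> computable n (\<lambda>v. v i)"
  unfolding computable_def
proof (intro exI allI)
  fix v assume "i < n"
  then show "computes (Proj i) (map v [0..<n]) (v i)"
    using computes.Proj[of i "map v [0..<n]"] by simp
qed

lemma computable_comp:
  assumes F: "computable m F" and G: "\<And>i. i < m \<Longrightarrow> computable n (G i)"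
  shows "computable n (\<lambda>v. F (\<lambda>i. G i v))"
proof -
  from F obtain p where p: "\<And>v. computes p (map v [0..<m]) (F v)"
    by (auto simp: computable_def)
  from G obtain q where q: "\<And>i v. i < m \<Longrightarrow> computes (q i) (map v [0..<n]) (G i v)"
    unfolding computable_def by metis
  have "computes (Comp p (map q [0..<m])) (map v [0..<n]) (F (\<lambda>i. G i v))" for v
  proof (rule computes.Comp)
    show "list_all2 (\<lambda>g. computes g (map v [0..<n])) (map q [0..<m]) (map (\<lambda>i. G i v) [0..<m])"
      by (simp add: list_all2_conv_all_nth q)
  qed (rule p)
  then show ?thesis unfolding computable_def by blast
qed

lemma computable_comp1:
  assumes "computable 1 (\<lambda>v. f (v 0))" "computable n a"
  shows "computable n (\<lambda>v. f (a v))"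
  using computable_comp[OF assms(1), of n "\<lambda>_. a"] assms(2) by simp

lemma computable_comp2:
  assumes "computable 2 (\<lambda>v. f (v 0) (v 1))" "computable n a" "computable n b"
  shows "computable n (\<lambda>v. f (a v) (b v))"
  using computable_comp[OF assms(1), of n "\<lambda>i. if i = 0 then a else b"] assms(2,3) by simp

lemma computable_comp4:
  assumes "computable 4 (\<lambda>v. f (v 0) (v 1) (v 2) (v 3))"
    "computable n a" "computable n b" "computable n c" "computable n d"
  shows "computable n (\<lambda>v. f (a v) (b v) (c v) (d v))"
  using computable_comp[OF assms(1), of n
      "\<lambda>i. if i = 0 then a else if i = 1 then b else if i = 2 then c else d"] assms(2-5)
  by simp

lemma computable_Suc:
  assumes "computable n a"
  shows "computable n (\<lambda>v. Suc (a v))"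
proof (rule computable_comp1[OF _ assms])
  show "computable 1 (\<lambda>v. Suc (v 0))"
    unfolding computable_def by (intro exI[of _ Succ]) (simp add: computes.Succ)
qed

lemma computable_const: "computable n (\<lambda>_. k)"
proof (induction k)
  case 0
  show ?case unfolding computable_def by (intro exI[of _ Zero]) (simp add: computes.Zero)
next
  case (Suc k)
  then show ?case by (rule computable_Suc)
qed

text \<open>\<open>PrimRec\<close> passes counter and previous value in front of the parameters,
  hence the shift by two in \<open>g\<close>. Its own first argument is finally replaced by
  \<open>b\<close> through composition.\<close>

lemma computable_rec_nat:
  assumes f: "computable n f" and g: "computable (Suc (Suc n)) (\<lambda>v. g (v 0) (v (Suc 0)) (\<lambda>i. v (Suc (Suc i))))"
    and b: "computable n b"
  shows "computable n (\<lambda>v. rec_nat (f v) (\<lambda>k r. g k r v) (b v))"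
proof -
  from f obtain pf where pf: "\<And>v. computes pf (map v [0..<n]) (f v)"
    by (auto simp: computable_def)
  from g obtain pg where pg: "\<And>v. computes pg (map v [0..<Suc (Suc n)]) (g (v 0) (v (Suc 0)) (\<lambda>i. v (Suc (Suc i))))"
    by (auto simp: computable_def simp del: upt_Suc)
  have shift: "map (case_nat x v) [0..<Suc n] = x # map v [0..<n]" for x v n
    by (simp add: upt_conv_Cons map_Suc_upt[symmetric] del: upt_Suc)
  have rec: "computes (PrimRec pf pg) (k # map v [0..<n]) (rec_nat (f v) (\<lambda>k r. g k r v) k)" for k v
  proof (induction k)
    case 0
    show ?case by (simp add: computes.PrimRec_0 pf)
  next
    case (Suc k)
    show ?case
      using computes.PrimRec_Suc[OF Suc] pg[of "case_nat k (case_nat (rec_nat (f v) (\<lambda>k r. g k r v) k) v)"]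
      unfolding shift by simp
  qed
  have "computable (Suc n) (\<lambda>v. rec_nat (f (\<lambda>i. v (Suc i))) (\<lambda>k r. g k r (\<lambda>i. v (Suc i))) (v 0))"
    unfolding computable_def
  proof (intro exI allI)
    fix v :: "nat \<Rightarrow> nat"
    have "case_nat (v 0) (\<lambda>i. v (Suc i)) = v" by (rule ext) (simp split: nat.split)
    then have "map v [0..<Suc n] = v 0 # map (\<lambda>i. v (Suc i)) [0..<n]"
      using shift[of "v 0" "\<lambda>i. v (Suc i)" n] by simp
    then show "computes (PrimRec pf pg) (map v [0..<Suc n])
        (rec_nat (f (\<lambda>i. v (Suc i))) (\<lambda>k r. g k r (\<lambda>i. v (Suc i))) (v 0))"
      using rec[of "v 0" "\<lambda>i. v (Suc i)"] by simp
  qed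
  from computable_comp[OF this, of n "case_nat b (\<lambda>i v. v i)"] b computable_var show ?thesis
    by (simp split: nat.split)
qed

lemma computable_add:
  assumes "computable n a" "computable n b"
  shows "computable n (\<lambda>v. a v + b v)"
proof (rule computable_comp2[OF _ assms])
  have "computable 2 (\<lambda>v. rec_nat (v 0) (\<lambda>k r. Suc r) (v 1))"
    by (intro computable_rec_nat computable_Suc computable_var) simp_all
  moreover have "rec_nat x (\<lambda>k r. Suc r) y = x + y" for x y by (induction y) simp_all
  ultimately show "computable 2 (\<lambda>v. v 0 + v 1)" by simp
qed

lemma computable_mult:
  assumes "computable n a" "computable n b"
  shows "computable n (\<lambda>v. a v * b v)"
proof (rule computable_comp2[OF _ assms])
  have "computable 2 (\<lambda>v. rec_nat 0 (\<lambda>k r. r + v 0) (v 1))"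
    by (intro computable_rec_nat computable_add computable_const computable_var) simp_all
  moreover have "rec_nat 0 (\<lambda>k r. r + x) y = x * y" for x y :: nat by (induction y) simp_all
  ultimately show "computable 2 (\<lambda>v. v 0 * v 1)" by simp
qed

lemma computable_diff:
  assumes "computable n a" "computable n b"
  shows "computable n (\<lambda>v. a v - b v)"
proof (rule computable_comp2[OF _ assms])
  have "computable 1 (\<lambda>v. rec_nat 0 (\<lambda>k r. k) (v 0))"
    by (intro computable_rec_nat computable_const computable_var) simp_all
  moreover have "rec_nat 0 (\<lambda>k r. k) y = y - 1" for y :: nat by (cases y) simp_all
  ultimately have pred: "computable 1 (\<lambda>v. v 0 - 1)" by simp
  have "computable 2 (\<lambda>v. rec_nat (v 0) (\<lambda>k r. r - 1) (v 1))"
    by (intro computable_rec_nat computable_comp1[OF pred] computable_var) simp_all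
  moreover have "rec_nat x (\<lambda>k r. r - 1) y = x - y" for x y :: nat by (induction y) simp_all
  ultimately show "computable 2 (\<lambda>v. v 0 - v 1)" by simp
qed

lemma computable_power2:
  assumes "computable n a"
  shows "computable n (\<lambda>v. 2 ^ a v)"
proof (rule computable_comp1[OF _ assms])
  have "computable 1 (\<lambda>v. rec_nat 1 (\<lambda>k r. r + r) (v 0))"
    by (intro computable_rec_nat computable_add computable_const computable_var) simp_all
  moreover have "rec_nat 1 (\<lambda>k r. r + r) y = (2 :: nat) ^ y" for y by (induction y) simp_all
  ultimately show "computable 1 (\<lambda>v. 2 ^ v 0)" by simp
qed

lemma computable_prod_encode:
  assumes "computable n a" "computable n b"
  shows "computable n (\<lambda>v. prod_encode (a v, b v))"
proof (rule computable_comp2[OF _ assms])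
  have "computable 1 (\<lambda>v. rec_nat 0 (\<lambda>k r. r + Suc k) (v 0))"
    by (intro computable_rec_nat computable_add computable_Suc computable_const computable_var) simp_all
  moreover have "rec_nat 0 (\<lambda>k r. r + Suc k) y = triangle y" for y :: nat by (induction y) simp_all
  ultimately have tri: "computable 1 (\<lambda>v. triangle (v 0))" by simp
  have "computable 2 (\<lambda>v. triangle (v 0 + v 1) + v 0)"
    by (intro computable_add computable_comp1[OF tri] computable_var) simp_all
  then show "computable 2 (\<lambda>v. prod_encode (v 0, v 1))" by (simp add: prod_encode_def)
qed

lemma decidable_not: "decidable n P \<Longrightarrow> decidable n (\<lambda>v. \<not> P v)"
proof -
  assume "decidable n P"
  then have "computable n (\<lambda>v. 1 - of_bool (P v))" by (intro computable_diff computable_const)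
  moreover have "1 - of_bool b = (of_bool (\<not> b) :: nat)" for b by simp
  ultimately show ?thesis by simp
qed

lemma decidable_conj:
  assumes "decidable n P" "decidable n Q"
  shows "decidable n (\<lambda>v. P v \<and> Q v)"
  unfolding of_bool_conj by (intro computable_mult assms)

lemma decidable_disj:
  assumes "decidable n P" "decidable n Q"
  shows "decidable n (\<lambda>v. P v \<or> Q v)"
proof -
  have "decidable n (\<lambda>v. \<not> (\<not> P v \<and> \<not> Q v))"
    by (intro decidable_not decidable_conj assms)
  then show ?thesis unfolding de_Morgan_conj not_not .
qed

lemma decidable_imp:
  assumes "decidable n P" "decidable n Q"
  shows "decidable n (\<lambda>v. P v \<longrightarrow> Q v)"
proof -
  have "decidable n (\<lambda>v. \<not> P v \<or> Q v)"
    by (intro decidable_not decidable_disj assms)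
  then show ?thesis unfolding imp_conv_disj .
qed

lemma decidable_iff:
  assumes "decidable n P" "decidable n Q"
  shows "decidable n (\<lambda>v. P v \<longleftrightarrow> Q v)"
proof -
  have "decidable n (\<lambda>v. (P v \<longrightarrow> Q v) \<and> (Q v \<longrightarrow> P v))"
    by (intro decidable_imp decidable_conj assms)
  then show ?thesis unfolding iff_conv_conj_imp .
qed

lemma decidable_le:
  assumes "computable n a" "computable n b"
  shows "decidable n (\<lambda>v. a v \<le> b v)"
proof -
  have "computable n (\<lambda>v. 1 - (a v - b v))"
    by (intro computable_diff computable_const assms)
  moreover have "1 - (x - y) = of_bool (x \<le> y)" for x y :: nat by (cases "x \<le> y") auto
  ultimately show ?thesis by simp
qed

lemma decidable_less:
  assumes "computable n a" "computable n b"
  shows "decidable n (\<lambda>v. a v < b v)"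
  unfolding Suc_le_eq[symmetric] by (intro decidable_le computable_Suc assms)

lemma decidable_eq:
  assumes "computable n a" "computable n b"
  shows "decidable n (\<lambda>v. a v = b v)"
  unfolding order_eq_iff by (intro decidable_conj decidable_le assms)

lemma decidable_all_less:
  assumes b: "computable n b" and P: "decidable (Suc n) (\<lambda>v. P (v 0) (\<lambda>i. v (Suc i)))"
  shows "decidable n (\<lambda>v. \<forall>k<b v. P k v)"
proof -
  \<comment> \<open>\<open>G\<close> skips position 1, which holds the product accumulated by the
    recursion, so that \<open>P\<close> sees the bound variable followed by the old
    environment.\<close>
  define G where "G i = (if i = 0 then (\<lambda>v. v 0) else (\<lambda>v :: nat \<Rightarrow> nat. v (Suc i)))" for i :: nat
  have G: "computable (Suc (Suc n)) (G i)" if "i < Suc n" for i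
    using that computable_var[of 0 "Suc (Suc n)"] computable_var[of "Suc i" "Suc (Suc n)"]
    by (simp add: G_def)
  from computable_comp[OF P, of "Suc (Suc n)" G, OF G]
  have "computable (Suc (Suc n)) (\<lambda>v. of_bool (P (v 0) (\<lambda>i. v (Suc (Suc i)))))"
    by (simp add: G_def)
  then have "computable n (\<lambda>v. rec_nat 1 (\<lambda>k r. r * of_bool (P k v)) (b v))"
    by (intro computable_rec_nat computable_mult computable_const computable_var b) simp_all
  moreover have "rec_nat 1 (\<lambda>k r. r * of_bool (P k v)) m = (of_bool (\<forall>k<m. P k v) :: nat)" for m v
    by (induction m) (auto simp: less_Suc_eq)
  ultimately show ?thesis by simp
qed

lemma decidable_ex_less:
  assumes "computable n b" "decidable (Suc n) (\<lambda>v. P (v 0) (\<lambda>i. v (Suc i)))"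
  shows "decidable n (\<lambda>v. \<exists>k<b v. P k v)"
proof -
  have "decidable n (\<lambda>v. \<not> (\<forall>k<b v. \<not> P k v))"
    by (intro decidable_not decidable_all_less assms)
  then show ?thesis unfolding not_all not_imp not_not .
qed

lemma decidable_all_le:
  assumes "computable n b" "decidable (Suc n) (\<lambda>v. P (v 0) (\<lambda>i. v (Suc i)))"
  shows "decidable n (\<lambda>v. \<forall>k\<le>b v. P k v)"
  unfolding less_Suc_eq_le[symmetric] by (intro decidable_all_less computable_Suc assms)

lemma decidable_ex_le:
  assumes "computable n b" "decidable (Suc n) (\<lambda>v. P (v 0) (\<lambda>i. v (Suc i)))"
  shows "decidable n (\<lambda>v. \<exists>k\<le>b v. P k v)"
  unfolding less_Suc_eq_le[symmetric] by (intro decidable_ex_less computable_Suc assms)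

lemmas computability =
  computable_var computable_const computable_Suc computable_add computable_mult computable_diff
  computable_power2 computable_prod_encode
  decidable_not decidable_conj decidable_disj decidable_imp decidable_iff decidable_le decidable_less
  decidable_eq decidable_all_less decidable_ex_less decidable_all_le decidable_ex_le

section \<open>Binary digits, unbounded search and the tower function\<close>

text \<open>Division-free reading of bit \<open>x\<close>: \<open>q\<close> collects the digits
  above it and \<open>r\<close> those below. Both are bounded, so the calculus applies.\<close>

lemma mem_set_decode_iff:
  "x \<in> set_decode e \<longleftrightarrow> (\<exists>q\<le>e. \<exists>r<2 ^ x. e = (q + q + 1) * 2 ^ x + r)"
proof
  assume "x \<in> set_decode e"
  then obtain q where q: "e div 2 ^ x = 2 * q + 1" by (auto simp: set_decode_def elim: oddE)
  have "e = (q + q + 1) * 2 ^ x + e mod 2 ^ x"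
    using div_mult_mod_eq[of e "2 ^ x"] unfolding q by (simp add: mult_2)
  moreover have "q \<le> e" using q div_le_dividend[of e "2 ^ x"] by linarith
  ultimately show "\<exists>q\<le>e. \<exists>r<2 ^ x. e = (q + q + 1) * 2 ^ x + r"
    by (intro exI[of _ q] conjI exI[of _ "e mod 2 ^ x"]) simp_all
next
  assume "\<exists>q\<le>e. \<exists>r<2 ^ x. e = (q + q + 1) * 2 ^ x + r"
  then obtain q r where "r < 2 ^ x" and e: "e = (q + q + 1) * 2 ^ x + r" by blast
  then have "e div 2 ^ x = q + q + 1" unfolding e by (subst div_mult_self3) simp_all
  then show "x \<in> set_decode e" by (simp add: set_decode_def)
qed

text \<open>The relation is first decided on plain variables and \<open>a\<close>, \<open>b\<close>
  are substituted afterwards. Under a bounded quantifier they would otherwise have to be computed in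
  the shifted environment. The same pattern recurs below.\<close>

lemma decidable_mem_set_decode:
  assumes "computable n a" "computable n b"
  shows "decidable n (\<lambda>v. a v \<in> set_decode (b v))"
  by (rule computable_comp2[of "\<lambda>a b. of_bool (a \<in> set_decode b)", OF _ assms])
    (unfold mem_set_decode_iff, (intro computability; simp))

text \<open>\<open>R\<close> recognizes certificates and \<open>A\<close> reads off the answer.
  Existence makes the search halt; since every certificate answers correctly, so does the least
  one.\<close>

lemma decidable_on_by_search:
  assumes R: "decidable 2 (\<lambda>v. R (v 0) (v 1))" and A: "decidable 2 (\<lambda>v. A (v 0) (v 1))"
    and ex: "\<And>x. x \<in> I \<Longrightarrow> \<exists>k. R k (code x)"
    and correct: "\<And>x k. x \<in> I \<Longrightarrow> R k (code x) \<Longrightarrow> A k (code x) \<longleftrightarrow> P x"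
  shows "decidable_on code I P"
proof -
  have two: "map v [0..<2] = [v 0, v (1::nat)]" for v :: "nat \<Rightarrow> nat"
    by (simp add: numeral_2_eq_2)
  \<comment> \<open>\<open>Mu\<close> searches for a zero, hence the negation.\<close>
  obtain r where r': "\<And>v. computes r (map v [0..<2]) (of_bool (\<not> R (v 0) (v 1)))"
    using decidable_not[OF R] unfolding computable_def by blast
  have r: "computes r [k, c] (of_bool (\<not> R k c))" for k c
    using r'[of "case_nat k (\<lambda>_. c)"] unfolding two by simp
  obtain a where a': "\<And>v. computes a (map v [0..<2]) (of_bool (A (v 0) (v 1)))"
    using A unfolding computable_def by blast
  have a: "computes a [k, c] (of_bool (A k c))" for k c
    using a'[of "case_nat k (\<lambda>_. c)"] unfolding two by simp
  have "computes (Comp a [Mu r, Proj 0]) [code x] (if P x then 1 else 0)" if x: "x \<in> I" for x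
  proof -
    define k where "k = (LEAST k. R k (code x))"
    have k: "R k (code x)" unfolding k_def by (rule LeastI_ex) (rule ex[OF x])
    have "\<not> R j (code x)" if "j < k" for j using that unfolding k_def by (rule not_less_Least)
    then have "computes (Mu r) [code x] k"
      using r k by (intro computes.Mu) (metis of_bool_eq(1), metis One_nat_def of_bool_eq(2))
    moreover have "computes (Proj 0) [code x] (code x)" using computes.Proj[of 0 "[code x]"] by simp
    ultimately have "computes (Comp a [Mu r, Proj 0]) [code x] (of_bool (A k (code x)))"
      by (intro computes.Comp[of _ _ "[k, code x]"] a) simp
    then show ?thesis unfolding correct[OF x k] of_bool_def .
  qed
  then show ?thesis unfolding decidable_on_def by blast
qed

lemma computable_tower:
  assumes "computable n a" "computable n b"
  shows "computable n (\<lambda>v. tower (a v) (b v))"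
proof (rule computable_comp2[OF _ assms])
  have "computable 2 (\<lambda>v. rec_nat (2 ^ v 1) (\<lambda>k r. 2 ^ r) (v 0))"
    by (intro computable_rec_nat computability) simp_all
  moreover have "rec_nat (2 ^ y) (\<lambda>k r. 2 ^ r) x = tower x y" for x y :: nat by (induction x) simp_all
  ultimately show "computable 2 (\<lambda>v. tower (v 0) (v 1))" by simp
qed

lemma computable_model_bound:
  assumes "computable n a"
  shows "computable n (\<lambda>v. model_bound (a v))"
  unfolding model_bound_def by (intro computable_tower computability assms)

section \<open>Truth tables as certificates\<close>

text \<open>A number \<open>e\<close>, read as a finite set, codes a structure together with a variable assignment:
  row \<open>p\<close> of \<open>e\<close> is the set of all \<open>a\<close> with \<open>prod_encode (p, a)\<close> in \<open>e\<close>, and the rows named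
  by the pairs \<open>(0, x)\<close>, \<open>(1, X)\<close>, \<open>(2, i)\<close>, \<open>(3, a)\<close>, \<open>(4, 0)\<close> hold the value of the variable \<open>x\<close>,
  the set variable \<open>X\<close>, the predicate \<open>i\<close>, the value of the function at \<open>a\<close>, and the universe.\<close>

definition row_mem :: "nat \<Rightarrow> nat \<Rightarrow> nat \<Rightarrow> bool" where
  "row_mem e p a \<longleftrightarrow> prod_encode (p, a) \<in> set_decode e"

definition univ_mem :: "nat \<Rightarrow> nat \<Rightarrow> bool" where
  "univ_mem e a \<longleftrightarrow> row_mem e (prod_encode (4, 0)) a"

text \<open>Rows may contain numbers outside the universe. Intersecting with it here builds closure
  under the function into the reading of a code.\<close>

definition fun_rel :: "nat \<Rightarrow> nat \<Rightarrow> nat \<Rightarrow> bool" where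
  "fun_rel e a b \<longleftrightarrow> univ_mem e b \<and> row_mem e (prod_encode (3, a)) b"

definition var_rel :: "nat \<Rightarrow> nat \<Rightarrow> nat \<Rightarrow> bool" where
  "var_rel e x a \<longleftrightarrow> univ_mem e a \<and> row_mem e (prod_encode (0, x)) a"

text \<open>4 is the largest tag of a row name; its argument is a variable or predicate name up to
  \<open>c\<close> or an element below \<open>model_bound c\<close>, and the sum bounds
  both.\<close>

definition bit_bound :: "nat \<Rightarrow> nat" where
  "bit_bound c = Suc (prod_encode (prod_encode (4, c + model_bound c), model_bound c))"

text \<open>Bounded quantifiers make this decidable and lose nothing for codes below
  \<open>2 ^ bit_bound c\<close>, by \<open>rel_less\<close>. Variable names in a formula do not
  exceed its code, whence \<open>x \<le> c\<close>.\<close>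

definition good :: "nat \<Rightarrow> nat \<Rightarrow> bool" where
  "good c e \<longleftrightarrow> (\<exists>a<bit_bound c. univ_mem e a) \<and>
     (\<forall>a<bit_bound c. univ_mem e a \<longrightarrow> a < model_bound c) \<and>
     (\<forall>a<bit_bound c. univ_mem e a \<longrightarrow> (\<exists>b<bit_bound c. \<forall>b'<bit_bound c. fun_rel e a b' \<longleftrightarrow> b' = b)) \<and>
     (\<forall>x\<le>c. \<exists>a<bit_bound c. \<forall>a'<bit_bound c. var_rel e x a' \<longleftrightarrow> a' = a)"

definition agree_except :: "nat \<Rightarrow> nat \<Rightarrow> nat \<Rightarrow> nat \<Rightarrow> bool" where
  "agree_except c p e e' \<longleftrightarrow>
     (\<forall>p'<bit_bound c. \<forall>a<bit_bound c. p' \<noteq> p \<longrightarrow> (row_mem e' p' a \<longleftrightarrow> row_mem e p' a))"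

definition cert_true :: "nat \<Rightarrow> nat \<Rightarrow> nat \<Rightarrow> bool" where
  "cert_true T w e \<longleftrightarrow> prod_encode (0, prod_encode (w, e)) \<in> set_decode T"

text \<open>Marks the numbers on which the truth table makes a claim. \<open>valid\<close> marks
  \<open>c\<close>, and \<open>valid_fm\<close> hands the mark down to immediate subformulas, so a
  certificate can leave out numbers that code no formula.\<close>

definition cert_fm :: "nat \<Rightarrow> nat \<Rightarrow> bool" where
  "cert_fm T w \<longleftrightarrow> prod_encode (1, w) \<in> set_decode T"

definition cert_val :: "nat \<Rightarrow> nat \<Rightarrow> nat \<Rightarrow> nat \<Rightarrow> bool" where
  "cert_val T t e a \<longleftrightarrow> prod_encode (2, prod_encode (t, prod_encode (e, a))) \<in> set_decode T"

definition valid_tm :: "nat \<Rightarrow> nat \<Rightarrow> nat \<Rightarrow> nat \<Rightarrow> bool" where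
  "valid_tm T c t e \<longleftrightarrow> (\<forall>a<bit_bound c. cert_val T t e a \<longleftrightarrow>
     (\<exists>x\<le>c. t = prod_encode (0, x) \<and> var_rel e x a) \<or>
     (\<exists>u\<le>c. t = prod_encode (1, u) \<and> (\<exists>b<bit_bound c. cert_val T u e b \<and> fun_rel e b a)))"

text \<open>Tarski's clauses. Guessing the components \<open>x\<close> and \<open>y\<close> of
  \<open>w\<close> replaces the inverse of \<open>prod_encode\<close>; a quantifier ranges over the
  good codes that differ from \<open>e\<close> at most in the row of its variable.\<close>

definition valid_fm :: "nat \<Rightarrow> nat \<Rightarrow> nat \<Rightarrow> nat \<Rightarrow> bool" where
  "valid_fm T c w e \<longleftrightarrow> (\<forall>x\<le>c. \<forall>y\<le>c.
     (w = prod_encode (0, prod_encode (x, y)) \<longrightarrow>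
       (cert_true T w e \<longleftrightarrow> (\<exists>a<bit_bound c. cert_val T x e a \<and> cert_val T y e a))) \<and>
     (w = prod_encode (1, prod_encode (x, y)) \<longrightarrow>
       (cert_true T w e \<longleftrightarrow> (\<exists>a<bit_bound c. cert_val T y e a \<and> row_mem e (prod_encode (2, x)) a))) \<and>
     (w = prod_encode (2, prod_encode (x, y)) \<longrightarrow>
       (cert_true T w e \<longleftrightarrow> (\<exists>a<bit_bound c. cert_val T x e a \<and> row_mem e (prod_encode (1, y)) a))) \<and>
     (w = prod_encode (3, x) \<longrightarrow> cert_fm T x \<and> (cert_true T w e \<longleftrightarrow> \<not> cert_true T x e)) \<and>
     (w = prod_encode (4, prod_encode (x, y)) \<longrightarrow>
       cert_fm T x \<and> cert_fm T y \<and> (cert_true T w e \<longleftrightarrow> cert_true T x e \<and> cert_true T y e)) \<and>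
     (w = prod_encode (5, prod_encode (x, y)) \<longrightarrow>
       cert_fm T x \<and> cert_fm T y \<and> (cert_true T w e \<longleftrightarrow> cert_true T x e \<or> cert_true T y e)) \<and>
     (w = prod_encode (6, prod_encode (x, y)) \<longrightarrow>
       cert_fm T x \<and> cert_fm T y \<and> (cert_true T w e \<longleftrightarrow> (cert_true T x e \<longrightarrow> cert_true T y e))) \<and>
     (w = prod_encode (7, prod_encode (x, y)) \<longrightarrow> cert_fm T y \<and> (cert_true T w e \<longleftrightarrow>
       (\<exists>e'<2 ^ bit_bound c. good c e' \<and> agree_except c (prod_encode (0, x)) e e' \<and> cert_true T y e'))) \<and>
     (w = prod_encode (8, prod_encode (x, y)) \<longrightarrow> cert_fm T y \<and> (cert_true T w e \<longleftrightarrow>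
       (\<forall>e'<2 ^ bit_bound c. good c e' \<and> agree_except c (prod_encode (0, x)) e e' \<longrightarrow> cert_true T y e'))) \<and>
     (w = prod_encode (9, prod_encode (x, y)) \<longrightarrow> cert_fm T y \<and> (cert_true T w e \<longleftrightarrow>
       (\<exists>e'<2 ^ bit_bound c. good c e' \<and> agree_except c (prod_encode (1, x)) e e' \<and> cert_true T y e'))) \<and>
     (w = prod_encode (10, prod_encode (x, y)) \<longrightarrow> cert_fm T y \<and> (cert_true T w e \<longleftrightarrow>
       (\<forall>e'<2 ^ bit_bound c. good c e' \<and> agree_except c (prod_encode (1, x)) e e' \<longrightarrow> cert_true T y e'))))"

definition valid :: "nat \<Rightarrow> nat \<Rightarrow> bool" where
  "valid T c \<longleftrightarrow> cert_fm T c \<and>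
     (\<forall>w\<le>c. \<forall>e<2 ^ bit_bound c. good c e \<longrightarrow> valid_tm T c w e \<and> (cert_fm T w \<longrightarrow> valid_fm T c w e))"

definition accepts :: "nat \<Rightarrow> nat \<Rightarrow> bool" where
  "accepts T c \<longleftrightarrow> (\<exists>e<2 ^ bit_bound c. good c e \<and> cert_true T c e)"

section \<open>Decidability of the conditions on certificates\<close>

lemma decidable_row_mem:
  assumes "computable n e" "computable n p" "computable n a"
  shows "decidable n (\<lambda>v. row_mem (e v) (p v) (a v))"
  unfolding row_mem_def by (intro decidable_mem_set_decode computability assms)

lemma decidable_univ_mem:
  assumes "computable n e" "computable n a"
  shows "decidable n (\<lambda>v. univ_mem (e v) (a v))"
  unfolding univ_mem_def by (intro decidable_row_mem computability assms)

lemma decidable_fun_rel: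
  assumes "computable n e" "computable n a" "computable n b"
  shows "decidable n (\<lambda>v. fun_rel (e v) (a v) (b v))"
  unfolding fun_rel_def by (intro decidable_row_mem decidable_univ_mem computability assms)

lemma decidable_var_rel:
  assumes "computable n e" "computable n a" "computable n b"
  shows "decidable n (\<lambda>v. var_rel (e v) (a v) (b v))"
  unfolding var_rel_def by (intro decidable_row_mem decidable_univ_mem computability assms)

lemma computable_bit_bound:
  assumes "computable n a"
  shows "computable n (\<lambda>v. bit_bound (a v))"
  unfolding bit_bound_def by (intro computable_model_bound computability assms)

lemma decidable_good:
  assumes "computable n c" "computable n e"
  shows "decidable n (\<lambda>v. good (c v) (e v))"
  by (rule computable_comp2[of "\<lambda>c e. of_bool (good c e)", OF _ assms])
    (unfold good_def, (intro computability computable_bit_bound computable_model_bound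
      decidable_univ_mem decidable_fun_rel decidable_var_rel; simp))

lemma decidable_agree_except:
  assumes "computable n c" "computable n p" "computable n e" "computable n e'"
  shows "decidable n (\<lambda>v. agree_except (c v) (p v) (e v) (e' v))"
  by (rule computable_comp4[of "\<lambda>c p e e'. of_bool (agree_except c p e e')", OF _ assms])
    (unfold agree_except_def, (intro computability computable_bit_bound decidable_row_mem; simp))

lemma decidable_cert_true:
  assumes "computable n T" "computable n w" "computable n e"
  shows "decidable n (\<lambda>v. cert_true (T v) (w v) (e v))"
  unfolding cert_true_def by (intro decidable_mem_set_decode computability assms)

lemma decidable_cert_fm:
  assumes "computable n T" "computable n w"
  shows "decidable n (\<lambda>v. cert_fm (T v) (w v))"
  unfolding cert_fm_def by (intro decidable_mem_set_decode computability assms)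

lemma decidable_cert_val:
  assumes "computable n T" "computable n t" "computable n e" "computable n a"
  shows "decidable n (\<lambda>v. cert_val (T v) (t v) (e v) (a v))"
  unfolding cert_val_def by (intro decidable_mem_set_decode computability assms)

lemmas cert_computability = computability computable_bit_bound decidable_good decidable_agree_except
  decidable_cert_true decidable_cert_fm decidable_cert_val decidable_row_mem decidable_fun_rel decidable_var_rel

lemma decidable_valid_tm:
  assumes "computable n T" "computable n c" "computable n t" "computable n e"
  shows "decidable n (\<lambda>v. valid_tm (T v) (c v) (t v) (e v))"
  by (rule computable_comp4[of "\<lambda>T c t e. of_bool (valid_tm T c t e)", OF _ assms])
    (unfold valid_tm_def, (intro cert_computability; simp))

lemma decidable_valid_fm:
  assumes "computable n T" "computable n c" "computable n w" "computable n e"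
  shows "decidable n (\<lambda>v. valid_fm (T v) (c v) (w v) (e v))"
  by (rule computable_comp4[of "\<lambda>T c w e. of_bool (valid_fm T c w e)", OF _ assms])
    (unfold valid_fm_def, (intro cert_computability; simp))

lemma decidable_valid: "decidable 2 (\<lambda>v. valid (v 0) (v 1))"
  unfolding valid_def by (intro cert_computability decidable_valid_tm decidable_valid_fm) simp_all

lemma decidable_accepts: "decidable 2 (\<lambda>v. accepts (v 0) (v 1))"
  unfolding accepts_def by (intro cert_computability) simp_all

section \<open>Reading numbers as structures with assignments\<close>

definition code_struct :: "nat \<Rightarrow> nat struct" where
  "code_struct e = \<lparr>universe = {a. univ_mem e a}, func = (\<lambda>a. THE b. fun_rel e a b),
     preds = (\<lambda>i. {a. univ_mem e a \<and> row_mem e (prod_encode (2, i)) a})\<rparr>"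

definition code_var :: "nat \<Rightarrow> nat \<Rightarrow> nat" where
  "code_var e x = (THE a. var_rel e x a)"

definition code_set :: "nat \<Rightarrow> nat \<Rightarrow> nat set" where
  "code_set e X = {a. univ_mem e a \<and> row_mem e (prod_encode (1, X)) a}"

definition code_sat :: "nat \<Rightarrow> fm \<Rightarrow> bool" where
  "code_sat e \<phi> \<longleftrightarrow> sat (code_struct e) (code_var e) (code_set e) \<phi>"

definition envs :: "nat \<Rightarrow> nat set" where
  "envs c = {e. e < 2 ^ bit_bound c \<and> good c e}"

lemma mem_set_decode_less:
  assumes "e < 2 ^ q" "k \<in> set_decode e"
  shows "k < q"
proof -
  have "2 ^ k \<le> e"
  proof (rule ccontr)
    assume "\<not> 2 ^ k \<le> e"
    then have "e div 2 ^ k = 0" by simp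
    then show False using assms(2) by (simp add: set_decode_def)
  qed
  then have "(2 :: nat) ^ k < 2 ^ q" using assms(1) by (rule le_less_trans)
  then show ?thesis by simp
qed

lemma row_mem_less:
  assumes "e < 2 ^ q" "row_mem e p a"
  shows "p < q" "a < q"
  using mem_set_decode_less[OF assms(1), of "prod_encode (p, a)"] assms(2) add_le_prod_encode[of p a]
  by (auto simp: row_mem_def)

lemma rel_less:
  assumes "e < 2 ^ q"
  shows "univ_mem e a \<Longrightarrow> a < q" "fun_rel e b a \<Longrightarrow> a < q" "var_rel e x a \<Longrightarrow> a < q"
  using row_mem_less[OF assms] by (auto simp: univ_mem_def fun_rel_def var_rel_def)

text \<open>All bits of such an \<open>e\<close> lie below \<open>bit_bound c\<close>, so witnesses
  of the unbounded conditions automatically respect the bounds in \<open>good\<close>.\<close>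

lemma goodI:
  assumes "e < 2 ^ bit_bound c" "univ_mem e a0" "\<And>a. univ_mem e a \<Longrightarrow> a < model_bound c"
    and "\<And>a. univ_mem e a \<Longrightarrow> \<exists>b. \<forall>b'. fun_rel e a b' \<longleftrightarrow> b' = b"
    and "\<And>x. x \<le> c \<Longrightarrow> \<exists>a. \<forall>a'. var_rel e x a' \<longleftrightarrow> a' = a"
  shows "e \<in> envs c"
proof -
  have "\<exists>b<bit_bound c. \<forall>b'<bit_bound c. fun_rel e a b' \<longleftrightarrow> b' = b" if "univ_mem e a" for a
  proof -
    from assms(4)[OF that] obtain b where b: "\<forall>b'. fun_rel e a b' \<longleftrightarrow> b' = b" by blast
    then have "b < bit_bound c" using rel_less(2)[OF assms(1), of a b] by simp
    with b show ?thesis by (intro exI[of _ b]) simp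
  qed
  moreover have "\<exists>a<bit_bound c. \<forall>a'<bit_bound c. var_rel e x a' \<longleftrightarrow> a' = a" if "x \<le> c" for x
  proof -
    from assms(5)[OF that] obtain a where a: "\<forall>a'. var_rel e x a' \<longleftrightarrow> a' = a" by blast
    then have "a < bit_bound c" using rel_less(3)[OF assms(1), of x a] by simp
    with a show ?thesis by (intro exI[of _ a]) simp
  qed
  moreover have "a0 < bit_bound c" using rel_less(1)[OF assms(1)] assms(2) by simp
  ultimately show ?thesis using assms(1-3) unfolding envs_def good_def by (simp add: exI[of _ a0])
qed

lemma envs_less: "e \<in> envs c \<Longrightarrow> e < 2 ^ bit_bound c"
  by (simp add: envs_def)

lemma envs_univ:
  assumes "e \<in> envs c"
  shows "\<exists>a. univ_mem e a" "univ_mem e a \<Longrightarrow> a < model_bound c"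
proof -
  show "\<exists>a. univ_mem e a" using assms unfolding envs_def good_def by blast
  show "univ_mem e a \<Longrightarrow> a < model_bound c"
    using assms rel_less(1)[OF envs_less[OF assms], of a] unfolding envs_def good_def by simp
qed

lemma envs_fun_ex:
  assumes e: "e \<in> envs c" and a: "univ_mem e a"
  shows "\<exists>b. \<forall>b'. fun_rel e a b' \<longleftrightarrow> b' = b"
proof -
  have "a < bit_bound c" using rel_less(1)[OF envs_less[OF e]] a by simp
  then obtain b where b: "b < bit_bound c" "\<And>b'. b' < bit_bound c \<Longrightarrow> fun_rel e a b' \<longleftrightarrow> b' = b"
    using e a unfolding envs_def good_def by blast
  then have "fun_rel e a b' \<longleftrightarrow> b' = b" for b'
    using rel_less(2)[OF envs_less[OF e], of a b'] by auto
  then show ?thesis by blast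
qed

lemma envs_fun:
  assumes "e \<in> envs c" "univ_mem e a"
  shows "fun_rel e a b \<longleftrightarrow> b = func (code_struct e) a"
proof -
  obtain b0 where "\<And>b'. fun_rel e a b' \<longleftrightarrow> b' = b0" using envs_fun_ex[OF assms] by blast
  then have "fun_rel e a = (\<lambda>b'. b' = b0)" by (intro ext)
  then show ?thesis by (simp add: code_struct_def)
qed

lemma envs_var_ex:
  assumes e: "e \<in> envs c" and x: "x \<le> c"
  shows "\<exists>a. \<forall>a'. var_rel e x a' \<longleftrightarrow> a' = a"
proof -
  obtain a where a: "a < bit_bound c" "\<And>a'. a' < bit_bound c \<Longrightarrow> var_rel e x a' \<longleftrightarrow> a' = a"
    using e x unfolding envs_def good_def by blast
  then have "var_rel e x a' \<longleftrightarrow> a' = a" for a'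
    using rel_less(3)[OF envs_less[OF e], of x a'] by auto
  then show ?thesis by blast
qed

lemma envs_var:
  assumes "e \<in> envs c" "x \<le> c"
  shows "var_rel e x a \<longleftrightarrow> a = code_var e x"
proof -
  obtain a0 where "\<And>a'. var_rel e x a' \<longleftrightarrow> a' = a0" using envs_var_ex[OF assms] by blast
  then have "var_rel e x = (\<lambda>a'. a' = a0)" by (intro ext)
  then show ?thesis by (simp add: code_var_def)
qed

lemma code_var_univ: "e \<in> envs c \<Longrightarrow> x \<le> c \<Longrightarrow> code_var e x \<in> universe (code_struct e)"
  using envs_var[of e c x "code_var e x"] by (simp add: var_rel_def code_struct_def)

lemma is_struct_code_struct:
  assumes "e \<in> envs c"
  shows "is_struct (code_struct e)" "finite (universe (code_struct e))"
proof -
  have "func (code_struct e) a \<in> universe (code_struct e)" if "univ_mem e a" for a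
    using envs_fun[OF assms that, of "func (code_struct e) a"]
    by (simp add: fun_rel_def) (simp add: code_struct_def)
  then show "is_struct (code_struct e)"
    using envs_univ(1)[OF assms] unfolding is_struct_def by (auto simp: code_struct_def)
  have "universe (code_struct e) \<subseteq> {..<model_bound c}"
    using envs_univ(2)[OF assms] by (auto simp: code_struct_def)
  then show "finite (universe (code_struct e))" by (rule finite_subset) simp
qed

subsection \<open>Quantifiers\<close>

definition put_row :: "nat \<Rightarrow> nat set \<Rightarrow> nat \<Rightarrow> nat" where
  "put_row p S e = set_encode ({k \<in> set_decode e. \<forall>a. k \<noteq> prod_encode (p, a)} \<union> (\<lambda>a. prod_encode (p, a)) ` S)"

lemma row_mem_put_row:
  assumes "finite S"
  shows "row_mem (put_row p S e) p' a \<longleftrightarrow> (if p' = p then a \<in> S else row_mem e p' a)"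
proof -
  have "finite ({k \<in> set_decode e. \<forall>a. k \<noteq> prod_encode (p, a)} \<union> (\<lambda>a. prod_encode (p, a)) ` S)"
    using assms by simp
  then show ?thesis by (auto simp: row_mem_def put_row_def)
qed

lemma bit_bound_less:
  assumes "p \<le> prod_encode (4, c + model_bound c)" "a < model_bound c"
  shows "prod_encode (p, a) < bit_bound c"
  unfolding bit_bound_def less_Suc_eq_le using assms by (intro prod_encode_mono) simp_all

lemma put_row_less:
  assumes e: "e < 2 ^ bit_bound c" and "S \<subseteq> {..<model_bound c}" "p \<le> prod_encode (4, c + model_bound c)"
  shows "put_row p S e < 2 ^ bit_bound c"
  unfolding put_row_def using assms(2,3) mem_set_decode_less[OF e]
  by (intro set_encode_less) (auto intro: bit_bound_less)

lemma agree_except_put_row: "finite S \<Longrightarrow> agree_except c p e (put_row p S e)"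
  by (simp add: agree_except_def row_mem_put_row)

text \<open>Beyond the bounds in \<open>agree_except\<close> neither code has a bit, so agreement
  holds everywhere.\<close>

lemma agree_exceptD:
  assumes "agree_except c p e e'" "e < 2 ^ bit_bound c" "e' < 2 ^ bit_bound c" "p' \<noteq> p"
  shows "row_mem e' p' a \<longleftrightarrow> row_mem e p' a"
  using assms(1,4) row_mem_less[OF assms(2), of p' a] row_mem_less[OF assms(3), of p' a]
  unfolding agree_except_def by blast

lemma agree_var:
  assumes "agree_except c (prod_encode (0, x)) e e'" "e \<in> envs c" "e' \<in> envs c"
  shows "code_struct e' = code_struct e" "code_set e' = code_set e"
    "code_var e' = (code_var e)(x := code_var e' x)"
proof -
  note r = agree_exceptD[OF assms(1) envs_less[OF assms(2)] envs_less[OF assms(3)]]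
  have u: "univ_mem e' = univ_mem e" by (rule ext) (simp add: univ_mem_def r)
  have f: "fun_rel e' = fun_rel e" by (intro ext) (simp add: fun_rel_def r u)
  show "code_struct e' = code_struct e" by (simp add: code_struct_def u f r)
  show "code_set e' = code_set e" by (rule ext) (simp add: code_set_def u r)
  have "var_rel e' y = var_rel e y" if "y \<noteq> x" for y
    using that by (intro ext) (simp add: var_rel_def u r)
  then show "code_var e' = (code_var e)(x := code_var e' x)" by (intro ext) (simp add: code_var_def)
qed

lemma agree_set:
  assumes "agree_except c (prod_encode (1, X)) e e'" "e \<in> envs c" "e' \<in> envs c"
  shows "code_struct e' = code_struct e" "code_var e' = code_var e"
    "code_set e' = (code_set e)(X := code_set e' X)"
proof -
  note r = agree_exceptD[OF assms(1) envs_less[OF assms(2)] envs_less[OF assms(3)]]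
  have u: "univ_mem e' = univ_mem e" by (rule ext) (simp add: univ_mem_def r)
  have f: "fun_rel e' = fun_rel e" by (intro ext) (simp add: fun_rel_def r u)
  have v: "var_rel e' = var_rel e" by (intro ext) (simp add: var_rel_def r u)
  show "code_struct e' = code_struct e" by (simp add: code_struct_def u f r)
  show "code_var e' = code_var e" by (rule ext) (simp add: code_var_def v)
  show "code_set e' = (code_set e)(X := code_set e' X)" by (rule ext) (simp add: code_set_def u r)
qed

lemma position_le:
  assumes "i \<le> 4" "x \<le> c + model_bound c"
  shows "prod_encode (i, x) \<le> prod_encode (4, c + model_bound c)"
  using assms by (rule prod_encode_mono)

lemma put_var:
  assumes e: "e \<in> envs c" and x: "x \<le> c" and a: "a \<in> universe (code_struct e)"
  obtains e' where "e' \<in> envs c" "agree_except c (prod_encode (0, x)) e e'" "code_var e' x = a"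
proof -
  define e' where "e' = put_row (prod_encode (0, x)) {a} e"
  have ua: "univ_mem e a" using a by (simp add: code_struct_def)
  have r: "row_mem e' p b \<longleftrightarrow> (if p = prod_encode (0, x) then b = a else row_mem e p b)" for p b
    by (simp add: e'_def row_mem_put_row)
  have u: "univ_mem e' b \<longleftrightarrow> univ_mem e b" for b by (simp add: univ_mem_def r)
  have f: "fun_rel e' b b' \<longleftrightarrow> fun_rel e b b'" for b b' by (simp add: fun_rel_def r u)
  have v: "var_rel e' y b \<longleftrightarrow> (if y = x then b = a else var_rel e y b)" for y b
    using ua by (auto simp: var_rel_def r u)
  have less: "e' < 2 ^ bit_bound c"
    unfolding e'_def using envs_less[OF e] envs_univ(2)[OF e ua] x by (intro put_row_less position_le) auto
  have "e' \<in> envs c"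
  proof (rule goodI[OF less])
    show "univ_mem e' a" using ua by (simp add: u)
    show "univ_mem e' b \<Longrightarrow> b < model_bound c" for b using envs_univ(2)[OF e] by (simp add: u)
    show "univ_mem e' b \<Longrightarrow> \<exists>b''. \<forall>b'. fun_rel e' b b' \<longleftrightarrow> b' = b''" for b
      using envs_fun_ex[OF e] by (simp add: u f)
    show "\<exists>b. \<forall>b'. var_rel e' y b' \<longleftrightarrow> b' = b" if "y \<le> c" for y
      using envs_var_ex[OF e that] by (cases "y = x") (auto simp: v)
  qed
  moreover have "agree_except c (prod_encode (0, x)) e e'"
    unfolding e'_def by (rule agree_except_put_row) simp
  moreover have "code_var e' x = a" by (simp add: code_var_def v)
  ultimately show thesis by (rule that)
qed

lemma put_set:
  assumes e: "e \<in> envs c" and X: "X \<le> c" and S: "S \<subseteq> universe (code_struct e)"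
  obtains e' where "e' \<in> envs c" "agree_except c (prod_encode (1, X)) e e'" "code_set e' X = S"
proof -
  define e' where "e' = put_row (prod_encode (1, X)) S e"
  have uS: "a \<in> S \<Longrightarrow> univ_mem e a" for a using S by (auto simp: code_struct_def)
  then have Sb: "S \<subseteq> {..<model_bound c}" using envs_univ(2)[OF e] by auto
  then have fin: "finite S" by (rule finite_subset) simp
  have r: "row_mem e' p b \<longleftrightarrow> (if p = prod_encode (1, X) then b \<in> S else row_mem e p b)" for p b
    by (simp add: e'_def row_mem_put_row[OF fin])
  have u: "univ_mem e' b \<longleftrightarrow> univ_mem e b" for b by (simp add: univ_mem_def r)
  have f: "fun_rel e' b b' \<longleftrightarrow> fun_rel e b b'" for b b' by (simp add: fun_rel_def r u)
  have v: "var_rel e' y b \<longleftrightarrow> var_rel e y b" for y b by (simp add: var_rel_def r u)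
  have less: "e' < 2 ^ bit_bound c"
    unfolding e'_def using envs_less[OF e] Sb X by (intro put_row_less position_le) auto
  obtain a0 where a0: "univ_mem e a0" using envs_univ(1)[OF e] by blast
  have "e' \<in> envs c"
  proof (rule goodI[OF less])
    show "univ_mem e' a0" using a0 by (simp add: u)
    show "univ_mem e' b \<Longrightarrow> b < model_bound c" for b using envs_univ(2)[OF e] by (simp add: u)
    show "univ_mem e' b \<Longrightarrow> \<exists>b''. \<forall>b'. fun_rel e' b b' \<longleftrightarrow> b' = b''" for b
      using envs_fun_ex[OF e] by (simp add: u f)
    show "\<exists>b. \<forall>b'. var_rel e' y b' \<longleftrightarrow> b' = b" if "y \<le> c" for y
      using envs_var_ex[OF e that] by (simp add: v)
  qed
  moreover have "agree_except c (prod_encode (1, X)) e e'"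
    unfolding e'_def by (rule agree_except_put_row[OF fin])
  moreover have "code_set e' X = S" using uS by (auto simp: code_set_def u r)
  ultimately show thesis by (rule that)
qed

text \<open>Every element is the value of \<open>x\<close> in some admissible code
  (\<open>put_var\<close>); conversely an agreeing code changes nothing but that value
  (\<open>agree_var\<close>).\<close>

lemma code_sat_Ex:
  assumes e: "e \<in> envs c" and x: "x \<le> c"
  shows "code_sat e (Ex x \<phi>) \<longleftrightarrow>
    (\<exists>e'<2 ^ bit_bound c. good c e' \<and> agree_except c (prod_encode (0, x)) e e' \<and> code_sat e' \<phi>)"
proof
  assume "code_sat e (Ex x \<phi>)"
  then obtain a where a: "a \<in> universe (code_struct e)"
    and sat: "sat (code_struct e) ((code_var e)(x := a)) (code_set e) \<phi>" by (auto simp: code_sat_def)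
  obtain e' where e': "e' \<in> envs c" "agree_except c (prod_encode (0, x)) e e'" "code_var e' x = a"
    by (rule put_var[OF e x a])
  have "code_sat e' \<phi>"
    unfolding code_sat_def agree_var(1,2)[OF e'(2) e e'(1)]
    by (subst agree_var(3)[OF e'(2) e e'(1)]) (simp add: e'(3) sat)
  then show "\<exists>e'<2 ^ bit_bound c. good c e' \<and> agree_except c (prod_encode (0, x)) e e' \<and> code_sat e' \<phi>"
    using e' unfolding envs_def by blast
next
  assume "\<exists>e'<2 ^ bit_bound c. good c e' \<and> agree_except c (prod_encode (0, x)) e e' \<and> code_sat e' \<phi>"
  then obtain e' where e': "e' \<in> envs c" "agree_except c (prod_encode (0, x)) e e'" and "code_sat e' \<phi>"
    unfolding envs_def by blast
  note agree = agree_var[OF e'(2) e e'(1)]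
  from \<open>code_sat e' \<phi>\<close> have "sat (code_struct e) ((code_var e)(x := code_var e' x)) (code_set e) \<phi>"
    unfolding code_sat_def agree(1,2) agree(3)[symmetric] .
  moreover have "code_var e' x \<in> universe (code_struct e)"
    using code_var_univ[OF e'(1) x] unfolding agree(1) .
  ultimately show "code_sat e (Ex x \<phi>)" unfolding code_sat_def by auto
qed

lemma code_sat_ExSet:
  assumes e: "e \<in> envs c" and X: "X \<le> c"
  shows "code_sat e (ExSet X \<phi>) \<longleftrightarrow>
    (\<exists>e'<2 ^ bit_bound c. good c e' \<and> agree_except c (prod_encode (1, X)) e e' \<and> code_sat e' \<phi>)"
proof
  assume "code_sat e (ExSet X \<phi>)"
  then obtain S where S: "S \<subseteq> universe (code_struct e)"
    and sat: "sat (code_struct e) (code_var e) ((code_set e)(X := S)) \<phi>" by (auto simp: code_sat_def)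
  obtain e' where e': "e' \<in> envs c" "agree_except c (prod_encode (1, X)) e e'" "code_set e' X = S"
    by (rule put_set[OF e X S])
  have "code_sat e' \<phi>"
    unfolding code_sat_def agree_set(1,2)[OF e'(2) e e'(1)]
    by (subst agree_set(3)[OF e'(2) e e'(1)]) (simp add: e'(3) sat)
  then show "\<exists>e'<2 ^ bit_bound c. good c e' \<and> agree_except c (prod_encode (1, X)) e e' \<and> code_sat e' \<phi>"
    using e' unfolding envs_def by blast
next
  assume "\<exists>e'<2 ^ bit_bound c. good c e' \<and> agree_except c (prod_encode (1, X)) e e' \<and> code_sat e' \<phi>"
  then obtain e' where e': "e' \<in> envs c" "agree_except c (prod_encode (1, X)) e e'" and "code_sat e' \<phi>"
    unfolding envs_def by blast
  note agree = agree_set[OF e'(2) e e'(1)]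
  from \<open>code_sat e' \<phi>\<close> have "sat (code_struct e) (code_var e) ((code_set e)(X := code_set e' X)) \<phi>"
    unfolding code_sat_def agree(1,2) agree(3)[symmetric] .
  moreover have "code_set e' X \<subseteq> universe (code_struct e)"
    unfolding agree(1)[symmetric] by (auto simp: code_set_def code_struct_def)
  ultimately show "code_sat e (ExSet X \<phi>)" unfolding code_sat_def by auto
qed

lemma code_sat_All:
  assumes "e \<in> envs c" "x \<le> c"
  shows "code_sat e (All x \<phi>) \<longleftrightarrow>
    (\<forall>e'<2 ^ bit_bound c. good c e' \<and> agree_except c (prod_encode (0, x)) e e' \<longrightarrow> code_sat e' \<phi>)"
proof -
  have "code_sat e (All x \<phi>) \<longleftrightarrow> \<not> code_sat e (Ex x (Neg \<phi>))" by (simp add: code_sat_def)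
  then show ?thesis unfolding code_sat_Ex[OF assms] by (auto simp: code_sat_def)
qed

lemma code_sat_AllSet:
  assumes "e \<in> envs c" "X \<le> c"
  shows "code_sat e (AllSet X \<phi>) \<longleftrightarrow>
    (\<forall>e'<2 ^ bit_bound c. good c e' \<and> agree_except c (prod_encode (1, X)) e e' \<longrightarrow> code_sat e' \<phi>)"
proof -
  have "code_sat e (AllSet X \<phi>) \<longleftrightarrow> \<not> code_sat e (ExSet X (Neg \<phi>))" by (simp add: code_sat_def)
  then show ?thesis unfolding code_sat_ExSet[OF assms] by (auto simp: code_sat_def)
qed

section \<open>Values of terms in a coded structure\<close>

definition code_val :: "nat \<Rightarrow> tm \<Rightarrow> nat" where
  "code_val e t = tm_val (code_struct e) (code_var e) t"

lemma code_val_univ: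
  assumes e: "e \<in> envs c" and "tm_code t \<le> c"
  shows "univ_mem e (code_val e t)"
  using assms(2)
proof (induction t)
  case (Var x)
  then have "x \<le> c" using add_le_prod_encode[of 0 x] by simp
  then show ?case using code_var_univ[OF e] by (simp add: code_val_def code_struct_def)
next
  case (App t)
  then have "univ_mem e (code_val e t)" using less_prod_encode[of 1 "tm_code t"] by simp
  then show ?case
    using is_struct_code_struct(1)[OF e] by (simp add: is_struct_def code_val_def) (simp add: code_struct_def)
qed

lemma code_val_less: "e \<in> envs c \<Longrightarrow> tm_code t \<le> c \<Longrightarrow> code_val e t < bit_bound c"
  using code_val_univ rel_less(1) envs_less by blast

subsection \<open>Correctness of valid certificates\<close>

lemma code_sat_simps:
  "code_sat e (Neg \<phi>) \<longleftrightarrow> \<not> code_sat e \<phi>"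
  "code_sat e (Conj \<phi> \<psi>) \<longleftrightarrow> code_sat e \<phi> \<and> code_sat e \<psi>"
  "code_sat e (Disj \<phi> \<psi>) \<longleftrightarrow> code_sat e \<phi> \<or> code_sat e \<psi>"
  "code_sat e (Imp \<phi> \<psi>) \<longleftrightarrow> (code_sat e \<phi> \<longrightarrow> code_sat e \<psi>)"
  by (simp_all add: code_sat_def)

text \<open>The bounded witnesses imitate the clauses of \<open>valid_fm\<close>, which reach the
  value of a term only through the relation \<open>cert_val\<close>.\<close>

lemma code_sat_atoms:
  assumes e: "e \<in> envs c"
  shows "tm_code t \<le> c \<Longrightarrow> tm_code u \<le> c \<Longrightarrow> code_sat e (Eq t u) \<longleftrightarrow> (\<exists>a<bit_bound c. a = code_val e t \<and> a = code_val e u)"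
    and "tm_code t \<le> c \<Longrightarrow> code_sat e (Pred i t) \<longleftrightarrow> (\<exists>a<bit_bound c. a = code_val e t \<and> row_mem e (prod_encode (2, i)) a)"
    and "tm_code t \<le> c \<Longrightarrow> code_sat e (Mem t X) \<longleftrightarrow> (\<exists>a<bit_bound c. a = code_val e t \<and> row_mem e (prod_encode (1, X)) a)"
proof -
  show "code_sat e (Eq t u) \<longleftrightarrow> (\<exists>a<bit_bound c. a = code_val e t \<and> a = code_val e u)" if "tm_code t \<le> c"
    using code_val_less[OF e that] by (auto simp: code_sat_def code_val_def)
  show "code_sat e (Pred i t) \<longleftrightarrow> (\<exists>a<bit_bound c. a = code_val e t \<and> row_mem e (prod_encode (2, i)) a)" if "tm_code t \<le> c"
    using code_val_less[OF e that] code_val_univ[OF e that] unfolding code_val_def code_sat_def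
    by (auto simp: code_struct_def)
  show "code_sat e (Mem t X) \<longleftrightarrow> (\<exists>a<bit_bound c. a = code_val e t \<and> row_mem e (prod_encode (1, X)) a)" if "tm_code t \<le> c"
    using code_val_less[OF e that] code_val_univ[OF e that] unfolding code_val_def code_sat_def
    by (auto simp: code_set_def)
qed

lemma valid_tm_correct:
  assumes valid: "\<And>w. w \<le> c \<Longrightarrow> valid_tm T c w e" and e: "e \<in> envs c"
  shows "tm_code t \<le> c \<Longrightarrow> a < bit_bound c \<Longrightarrow> cert_val T (tm_code t) e a \<longleftrightarrow> a = code_val e t"
proof (induction t arbitrary: a)
  case (Var x)
  then have x: "x \<le> c" using add_le_prod_encode[of 0 x] by simp
  then show ?case using valid[OF Var(1)] Var(2) envs_var[OF e x, of a]
    by (auto simp: valid_tm_def code_val_def)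
next
  case (App t)
  then have t: "tm_code t \<le> c" using less_prod_encode[of 1 "tm_code t"] by simp
  have "cert_val T (tm_code (App t)) e a \<longleftrightarrow>
      (\<exists>b<bit_bound c. cert_val T (tm_code t) e b \<and> fun_rel e b a)"
    using valid[OF App.prems(1)] App.prems(2) t by (auto simp: valid_tm_def)
  also have "\<dots> \<longleftrightarrow> (\<exists>b<bit_bound c. b = code_val e t \<and> fun_rel e b a)"
    using App.IH[OF t] by blast
  also have "\<dots> \<longleftrightarrow> fun_rel e (code_val e t) a"
    using code_val_less[OF e t] by blast
  also have "\<dots> \<longleftrightarrow> a = code_val e (App t)"
    unfolding envs_fun[OF e code_val_univ[OF e t]] by (simp add: code_val_def)
  finally show ?case .
qed

text \<open>Local consistency determines the table by induction on the formula. The code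
  \<open>e\<close> must be arbitrary in the induction, because quantifiers move to other
  codes.\<close>

lemma valid_correct:
  assumes valid: "valid T c"
  shows "fm_code \<phi> \<le> c \<Longrightarrow> cert_fm T (fm_code \<phi>) \<Longrightarrow> e \<in> envs c \<Longrightarrow>
    cert_true T (fm_code \<phi>) e \<longleftrightarrow> code_sat e \<phi>"
proof (induction \<phi> arbitrary: e)
  have vt: "cert_val T (tm_code t) e a \<longleftrightarrow> a = code_val e t"
    if "e \<in> envs c" "tm_code t \<le> c" "a < bit_bound c" for t e a
    by (rule valid_tm_correct[OF _ that]) (use valid that(1) in \<open>simp add: valid_def envs_def\<close>)
  have vf: "valid_fm T c (fm_code \<phi>) e" if "fm_code \<phi> \<le> c" "cert_fm T (fm_code \<phi>)" "e \<in> envs c" for \<phi> e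
    using valid that by (simp add: valid_def envs_def)
  {
    case (Eq t u)
    have le: "tm_code t \<le> c" "tm_code u \<le> c"
      using Eq(1) add_le_prod_encode[of 0 "prod_encode (tm_code t, tm_code u)"]
        add_le_prod_encode[of "tm_code t" "tm_code u"] by simp_all
    from vf[OF Eq, unfolded valid_fm_def, rule_format, OF le]
    show ?case using vt[OF Eq(3)] le by (simp add: code_sat_atoms(1)[OF Eq(3) le]) blast
  next
    case (Pred i t)
    have le: "i \<le> c" "tm_code t \<le> c"
      using code_le_arguments[of 1 i "tm_code t" c] Pred(1) by simp_all
    from vf[OF Pred, unfolded valid_fm_def, rule_format, OF le]
    show ?case using vt[OF Pred(3)] le by (simp add: code_sat_atoms(2)[OF Pred(3) le(2)]) blast
  next
    case (Mem t X)
    have le: "tm_code t \<le> c" "X \<le> c"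
      using code_le_arguments[of 2 "tm_code t" X c] Mem(1) by simp_all
    from vf[OF Mem, unfolded valid_fm_def, rule_format, OF le]
    show ?case using vt[OF Mem(3)] le by (simp add: code_sat_atoms(3)[OF Mem(3) le(1)]) blast
  next
    case (Neg \<phi>)
    have le: "fm_code \<phi> \<le> c" using less_prod_encode[of 3 "fm_code \<phi>"] Neg.prems(1) by simp
    from vf[OF Neg.prems, unfolded valid_fm_def, rule_format, OF le le]
    show ?case using Neg.IH[OF le _ Neg.prems(3)] by (simp add: code_sat_simps)
  next
    case (Conj \<phi> \<psi>)
    have le: "fm_code \<phi> \<le> c" "fm_code \<psi> \<le> c"
      using code_le_arguments[of 4 "fm_code \<phi>" "fm_code \<psi>" c] Conj.prems(1) by simp_all
    from vf[OF Conj.prems, unfolded valid_fm_def, rule_format, OF le]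
    show ?case using Conj.IH(1)[OF le(1) _ Conj.prems(3)] Conj.IH(2)[OF le(2) _ Conj.prems(3)]
      by (simp add: code_sat_simps)
  next
    case (Disj \<phi> \<psi>)
    have le: "fm_code \<phi> \<le> c" "fm_code \<psi> \<le> c"
      using code_le_arguments[of 5 "fm_code \<phi>" "fm_code \<psi>" c] Disj.prems(1) by simp_all
    from vf[OF Disj.prems, unfolded valid_fm_def, rule_format, OF le]
    show ?case using Disj.IH(1)[OF le(1) _ Disj.prems(3)] Disj.IH(2)[OF le(2) _ Disj.prems(3)]
      by (simp add: code_sat_simps)
  next
    case (Imp \<phi> \<psi>)
    have le: "fm_code \<phi> \<le> c" "fm_code \<psi> \<le> c"
      using code_le_arguments[of 6 "fm_code \<phi>" "fm_code \<psi>" c] Imp.prems(1) by simp_all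
    from vf[OF Imp.prems, unfolded valid_fm_def, rule_format, OF le]
    show ?case using Imp.IH(1)[OF le(1) _ Imp.prems(3)] Imp.IH(2)[OF le(2) _ Imp.prems(3)]
      by (simp add: code_sat_simps)
  next
    case (Ex x \<phi>)
    have le: "x \<le> c" "fm_code \<phi> \<le> c"
      using code_le_arguments[of 7 x "fm_code \<phi>" c] Ex.prems(1) by simp_all
    from vf[OF Ex.prems, unfolded valid_fm_def, rule_format, OF le]
    show ?case using Ex.IH[OF le(2)]
      by (simp add: code_sat_Ex[OF Ex.prems(3) le(1)] envs_def) blast
  next
    case (All x \<phi>)
    have le: "x \<le> c" "fm_code \<phi> \<le> c"
      using code_le_arguments[of 8 x "fm_code \<phi>" c] All.prems(1) by simp_all
    from vf[OF All.prems, unfolded valid_fm_def, rule_format, OF le]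
    show ?case using All.IH[OF le(2)]
      by (simp add: code_sat_All[OF All.prems(3) le(1)] envs_def)
  next
    case (ExSet x \<phi>)
    have le: "x \<le> c" "fm_code \<phi> \<le> c"
      using code_le_arguments[of 9 x "fm_code \<phi>" c] ExSet.prems(1) by simp_all
    from vf[OF ExSet.prems, unfolded valid_fm_def, rule_format, OF le]
    show ?case using ExSet.IH[OF le(2)]
      by (simp add: code_sat_ExSet[OF ExSet.prems(3) le(1)] envs_def) blast
  next
    case (AllSet x \<phi>)
    have le: "x \<le> c" "fm_code \<phi> \<le> c"
      using code_le_arguments[of 10 x "fm_code \<phi>" c] AllSet.prems(1) by simp_all
    from vf[OF AllSet.prems, unfolded valid_fm_def, rule_format, OF le]
    show ?case using AllSet.IH[OF le(2)]
      by (simp add: code_sat_AllSet[OF AllSet.prems(3) le(1)] envs_def)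
  }
qed

subsection \<open>Existence of valid certificates\<close>

text \<open>The intended tables, cut down to codes up to \<open>c\<close> and to
  \<open>envs c\<close> so that they are finite and \<open>set_encode\<close> can be
  inverted.\<close>

definition certificate :: "nat \<Rightarrow> nat" where
  "certificate c = set_encode
     ({prod_encode (0, prod_encode (fm_code \<phi>, e)) |\<phi> e. fm_code \<phi> \<le> c \<and> e \<in> envs c \<and> code_sat e \<phi>} \<union>
      {prod_encode (1, fm_code \<phi>) |\<phi>. fm_code \<phi> \<le> c} \<union>
      {prod_encode (2, prod_encode (tm_code t, prod_encode (e, code_val e t))) |t e. tm_code t \<le> c \<and> e \<in> envs c})"

lemma set_decode_certificate:
  "set_decode (certificate c) =
     {prod_encode (0, prod_encode (fm_code \<phi>, e)) |\<phi> e. fm_code \<phi> \<le> c \<and> e \<in> envs c \<and> code_sat e \<phi>} \<union>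
     {prod_encode (1, fm_code \<phi>) |\<phi>. fm_code \<phi> \<le> c} \<union>
     {prod_encode (2, prod_encode (tm_code t, prod_encode (e, code_val e t))) |t e. tm_code t \<le> c \<and> e \<in> envs c}"
  (is "_ = ?A \<union> ?B \<union> ?C")
proof -
  have fin: "finite (envs c)"
    by (rule finite_subset[of _ "{..<2 ^ bit_bound c}"]) (auto simp: envs_def)
  have "?A \<subseteq> (\<lambda>(w, e). prod_encode (0, prod_encode (w, e))) ` ({..c} \<times> envs c)" by auto
  then have "finite ?A" by (rule finite_subset) (simp add: fin)
  moreover have "?B \<subseteq> (\<lambda>w. prod_encode (1, w)) ` {..c}" by auto
  then have "finite ?B" by (rule finite_subset) simp
  moreover have "?C \<subseteq> (\<lambda>(w, e, a). prod_encode (2, prod_encode (w, prod_encode (e, a)))) `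
      ({..c} \<times> envs c \<times> {..<bit_bound c})"
    using code_val_less by (auto simp: image_iff)
  then have "finite ?C" by (rule finite_subset) (simp add: fin)
  ultimately show ?thesis unfolding certificate_def by (intro set_encode_inverse finite_UnI)
qed

lemma cert_certificate:
  "cert_true (certificate c) w e \<longleftrightarrow> (\<exists>\<phi>. w = fm_code \<phi> \<and> w \<le> c \<and> e \<in> envs c \<and> code_sat e \<phi>)"
  "cert_fm (certificate c) w \<longleftrightarrow> (\<exists>\<phi>. w = fm_code \<phi> \<and> w \<le> c)"
  "cert_val (certificate c) w e a \<longleftrightarrow> (\<exists>t. w = tm_code t \<and> w \<le> c \<and> e \<in> envs c \<and> a = code_val e t)"
  unfolding cert_true_def cert_fm_def cert_val_def set_decode_certificate by auto

lemma cert_certificate_code: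
  "fm_code \<phi> \<le> c \<Longrightarrow> e \<in> envs c \<Longrightarrow> cert_true (certificate c) (fm_code \<phi>) e \<longleftrightarrow> code_sat e \<phi>"
  "fm_code \<phi> \<le> c \<Longrightarrow> cert_fm (certificate c) (fm_code \<phi>)"
  "tm_code t \<le> c \<Longrightarrow> e \<in> envs c \<Longrightarrow> cert_val (certificate c) (tm_code t) e a \<longleftrightarrow> a = code_val e t"
  unfolding cert_certificate using fm_code_inj tm_code_inj by blast+

lemma valid_tm_certificate:
  assumes e: "e \<in> envs c" and w: "w \<le> c"
  shows "valid_tm (certificate c) c w e"
  unfolding valid_tm_def
proof (intro allI impI)
  fix a assume a: "a < bit_bound c"
  show "cert_val (certificate c) w e a \<longleftrightarrow>
     (\<exists>x\<le>c. w = prod_encode (0, x) \<and> var_rel e x a) \<or>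
     (\<exists>u\<le>c. w = prod_encode (1, u) \<and> (\<exists>b<bit_bound c. cert_val (certificate c) u e b \<and> fun_rel e b a))"
  proof (cases "\<exists>t. w = tm_code t")
    case True
    then obtain t where t: "w = tm_code t" by blast
    show ?thesis
    proof (cases t)
      case (Var x)
      then have "x \<le> c" using w t add_le_prod_encode[of 0 x] by simp
      then show ?thesis
        using cert_certificate_code(3)[of t c e a] envs_var[OF e, of x a] t w e Var by (auto simp: code_val_def)
    next
      case (App u)
      then have u: "tm_code u \<le> c" using w t less_prod_encode[of 1 "tm_code u"] by simp
      have "cert_val (certificate c) w e a \<longleftrightarrow> fun_rel e (code_val e u) a"
        using cert_certificate_code(3)[of t c e a] t w e App
        unfolding envs_fun[OF e code_val_univ[OF e u]] by (simp add: code_val_def)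
      also have "\<dots> \<longleftrightarrow> (\<exists>b<bit_bound c. cert_val (certificate c) (tm_code u) e b \<and> fun_rel e b a)"
        unfolding cert_certificate_code(3)[OF u e] using code_val_less[OF e u] by blast
      finally show ?thesis using t App u by auto
    qed
  next
    \<comment> \<open>If \<open>w = prod_encode (1, u)\<close> codes no term, then neither does
      \<open>u\<close>, so both sides are false.\<close>
    case False
    then have "\<not> cert_val (certificate c) w e a" by (auto simp: cert_certificate)
    moreover have "w \<noteq> prod_encode (0, x)" for x using False tm_code.simps(1)[of x] by metis
    moreover have "w = prod_encode (1, u) \<Longrightarrow> \<not> cert_val (certificate c) u e b" for u b
      using False tm_code.simps(2) unfolding cert_certificate by metis
    ultimately show ?thesis by blast
  qed
qed

lemma valid_fm_certificate:
  assumes e: "e \<in> envs c" and w: "fm_code \<phi> \<le> c"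
  shows "valid_fm (certificate c) c (fm_code \<phi>) e"
proof -
  note cert = cert_certificate_code(1)[OF w e]
  have envs: "\<And>e'. e' < 2 ^ bit_bound c \<Longrightarrow> good c e' \<Longrightarrow> e' \<in> envs c" by (simp add: envs_def)
  show ?thesis
  proof (cases \<phi>)
    case (Eq t u)
    have le: "tm_code t \<le> c" "tm_code u \<le> c"
      using Eq w add_le_prod_encode[of 0 "prod_encode (tm_code t, tm_code u)"]
        add_le_prod_encode[of "tm_code t" "tm_code u"] by simp_all
    show ?thesis using cert unfolding valid_fm_def Eq
      by (auto simp: code_sat_atoms(1)[OF e le] cert_certificate_code(3)[OF _ e])
  next
    case (Pred i t)
    have le: "i \<le> c" "tm_code t \<le> c"
      using code_le_arguments[of 1 i "tm_code t" c] Pred w by simp_all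
    show ?thesis using cert unfolding valid_fm_def Pred
      by (auto simp: code_sat_atoms(2)[OF e le(2)] cert_certificate_code(3)[OF _ e])
  next
    case (Mem t X)
    have le: "tm_code t \<le> c" "X \<le> c"
      using code_le_arguments[of 2 "tm_code t" X c] Mem w by simp_all
    show ?thesis using cert unfolding valid_fm_def Mem
      by (auto simp: code_sat_atoms(3)[OF e le(1)] cert_certificate_code(3)[OF _ e])
  next
    case (Neg \<psi>)
    have le: "fm_code \<psi> \<le> c" using less_prod_encode[of 3 "fm_code \<psi>"] Neg w by simp
    show ?thesis using cert unfolding valid_fm_def Neg
      by (auto simp: code_sat_simps cert_certificate_code(1)[OF le e] cert_certificate_code(2)[OF le])
  next
    case (Conj \<psi> \<chi>)
    have le: "fm_code \<psi> \<le> c" "fm_code \<chi> \<le> c"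
      using code_le_arguments[of 4 "fm_code \<psi>" "fm_code \<chi>" c] Conj w by simp_all
    show ?thesis using cert unfolding valid_fm_def Conj
      by (auto simp: code_sat_simps cert_certificate_code(1)[OF le(1) e] cert_certificate_code(1)[OF le(2) e]
        cert_certificate_code(2)[OF le(1)] cert_certificate_code(2)[OF le(2)])
  next
    case (Disj \<psi> \<chi>)
    have le: "fm_code \<psi> \<le> c" "fm_code \<chi> \<le> c"
      using code_le_arguments[of 5 "fm_code \<psi>" "fm_code \<chi>" c] Disj w by simp_all
    show ?thesis using cert unfolding valid_fm_def Disj
      by (auto simp: code_sat_simps cert_certificate_code(1)[OF le(1) e] cert_certificate_code(1)[OF le(2) e]
        cert_certificate_code(2)[OF le(1)] cert_certificate_code(2)[OF le(2)])
  next
    case (Imp \<psi> \<chi>)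
    have le: "fm_code \<psi> \<le> c" "fm_code \<chi> \<le> c"
      using code_le_arguments[of 6 "fm_code \<psi>" "fm_code \<chi>" c] Imp w by simp_all
    show ?thesis using cert unfolding valid_fm_def Imp
      by (auto simp: code_sat_simps cert_certificate_code(1)[OF le(1) e] cert_certificate_code(1)[OF le(2) e]
        cert_certificate_code(2)[OF le(1)] cert_certificate_code(2)[OF le(2)])
  next
    case (Ex x \<psi>)
    have le: "x \<le> c" "fm_code \<psi> \<le> c"
      using code_le_arguments[of 7 x "fm_code \<psi>" c] Ex w by simp_all
    show ?thesis using cert unfolding valid_fm_def Ex
      by (auto simp: code_sat_Ex[OF e le(1)] cert_certificate_code(1)[OF le(2) envs] cert_certificate_code(2)[OF le(2)])
  next
    case (All x \<psi>)
    have le: "x \<le> c" "fm_code \<psi> \<le> c"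
      using code_le_arguments[of 8 x "fm_code \<psi>" c] All w by simp_all
    show ?thesis using cert unfolding valid_fm_def All
      by (auto simp: code_sat_All[OF e le(1)] cert_certificate_code(1)[OF le(2) envs] cert_certificate_code(2)[OF le(2)])
  next
    case (ExSet x \<psi>)
    have le: "x \<le> c" "fm_code \<psi> \<le> c"
      using code_le_arguments[of 9 x "fm_code \<psi>" c] ExSet w by simp_all
    show ?thesis using cert unfolding valid_fm_def ExSet
      by (auto simp: code_sat_ExSet[OF e le(1)] cert_certificate_code(1)[OF le(2) envs] cert_certificate_code(2)[OF le(2)])
  next
    case (AllSet x \<psi>)
    have le: "x \<le> c" "fm_code \<psi> \<le> c"
      using code_le_arguments[of 10 x "fm_code \<psi>" c] AllSet w by simp_all
    show ?thesis using cert unfolding valid_fm_def AllSet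
      by (auto simp: code_sat_AllSet[OF e le(1)] cert_certificate_code(1)[OF le(2) envs] cert_certificate_code(2)[OF le(2)])
  qed
qed

lemma valid_certificate: "valid (certificate (fm_code \<phi>)) (fm_code \<phi>)"
  unfolding valid_def
proof (intro conjI allI impI)
  show "cert_fm (certificate (fm_code \<phi>)) (fm_code \<phi>)" by (simp add: cert_certificate_code)
  fix w e assume w: "w \<le> fm_code \<phi>" and "e < 2 ^ bit_bound (fm_code \<phi>)" "good (fm_code \<phi>) e"
  then have e: "e \<in> envs (fm_code \<phi>)" by (simp add: envs_def)
  show "valid_tm (certificate (fm_code \<phi>)) (fm_code \<phi>) w e" by (rule valid_tm_certificate[OF e w])
  assume "cert_fm (certificate (fm_code \<phi>)) w"
  then obtain \<psi> where "w = fm_code \<psi>" by (auto simp: cert_certificate)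
  then show "valid_fm (certificate (fm_code \<phi>)) (fm_code \<phi>) w e" using valid_fm_certificate[OF e] w by simp
qed

section \<open>The decision procedure\<close>

text \<open>A code has finitely many bits, so it reproduces the function on the universe and the
  predicates up to \<open>c\<close> only.\<close>

lemma code_model:
  assumes M: "is_struct M" "universe M \<subseteq> {..<model_bound c}"
  obtains e where "e \<in> envs c" "universe (code_struct e) = universe M"
    "\<forall>a\<in>universe M. func (code_struct e) a = func M a" "\<forall>i\<le>c. preds (code_struct e) i = preds M i"
proof -
  obtain a0 where a0: "a0 \<in> universe M" using M(1) by (auto simp: is_struct_def)
  have fU: "a \<in> universe M \<Longrightarrow> func M a \<in> universe M" and pU: "preds M i \<subseteq> universe M" for a i
    using M(1) by (auto simp: is_struct_def)
  \<comment> \<open>\<open>good\<close> demands a value for every variable up to \<open>c\<close>;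
    all of them get \<open>a0\<close>. Set variables get empty rows.\<close>
  define R where "R p a \<longleftrightarrow> p = prod_encode (4, 0) \<and> a \<in> universe M \<or>
      (\<exists>b\<in>universe M. p = prod_encode (3, b) \<and> a = func M b) \<or>
      (\<exists>i\<le>c. p = prod_encode (2, i) \<and> a \<in> preds M i) \<or>
      (\<exists>x\<le>c. p = prod_encode (0, x) \<and> a = a0)" for p a
  define S where "S = prod_encode ` {(p, a). R p a}"
  define e where "e = set_encode S"
  have R: "p \<le> prod_encode (4, c + model_bound c) \<and> a < model_bound c" if "R p a" for p a
    using that M(2) fU pU a0 unfolding R_def by (auto intro!: position_le)
  then have sub: "S \<subseteq> {..<bit_bound c}" unfolding S_def using bit_bound_less by auto
  then have fin: "finite S" by (rule finite_subset) simp
  have less: "e < 2 ^ bit_bound c" unfolding e_def by (rule set_encode_less[OF sub])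
  have r: "row_mem e p a \<longleftrightarrow> R p a" for p a
    by (auto simp: row_mem_def e_def fin) (auto simp: S_def image_iff)
  have u: "univ_mem e a \<longleftrightarrow> a \<in> universe M" for a by (auto simp: univ_mem_def r R_def)
  have f: "fun_rel e a b \<longleftrightarrow> b = func M a" if "a \<in> universe M" for a b
    using that fU by (auto simp: fun_rel_def u r R_def)
  have v: "var_rel e x a \<longleftrightarrow> a = a0" if "x \<le> c" for x a
    using that a0 by (auto simp: var_rel_def u r R_def)
  have e: "e \<in> envs c"
  proof (rule goodI[OF less])
    show "univ_mem e a0" using a0 by (simp add: u)
    show "univ_mem e a \<Longrightarrow> a < model_bound c" for a using M(2) by (auto simp: u)
    show "univ_mem e a \<Longrightarrow> \<exists>b. \<forall>b'. fun_rel e a b' \<longleftrightarrow> b' = b" for a by (auto simp: u f)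
    show "x \<le> c \<Longrightarrow> \<exists>a. \<forall>a'. var_rel e x a' \<longleftrightarrow> a' = a" for x by (auto simp: v)
  qed
  have "\<forall>a\<in>universe M. func (code_struct e) a = func M a"
    using envs_fun[OF e] by (simp add: u f)
  moreover have "\<forall>i\<le>c. preds (code_struct e) i = preds M i"
    using pU by (auto simp: code_struct_def u r R_def)
  ultimately show thesis using e by (intro that[of e]) (simp_all add: code_struct_def u)
qed

lemma accepts_iff_has_finite_model:
  assumes \<phi>: "sentence \<phi>" and valid: "valid T (fm_code \<phi>)"
  shows "accepts T (fm_code \<phi>) \<longleftrightarrow> has_finite_model \<phi>"
proof -
  let ?c = "fm_code \<phi>"
  have "cert_fm T ?c" using valid by (simp add: valid_def)
  then have "accepts T ?c \<longleftrightarrow> (\<exists>e\<in>envs ?c. code_sat e \<phi>)"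
    using valid_correct[OF valid order_refl] by (auto simp: accepts_def envs_def)
  also have "\<dots> \<longleftrightarrow> has_finite_model \<phi>"
  proof
    assume "\<exists>e\<in>envs ?c. code_sat e \<phi>"
    then obtain e where e: "e \<in> envs ?c" and sat: "code_sat e \<phi>" by blast
    note struct = is_struct_code_struct[OF e]
    have "models (code_struct e) \<phi>"
      using sat sat_sentence_cong[OF \<phi> struct] unfolding models_def code_sat_def by blast
    then show "has_finite_model \<phi>" using struct unfolding has_finite_model_def by blast
  next
    assume "has_finite_model \<phi>"
    then obtain M :: "nat struct" where M: "is_struct M" "universe M \<subseteq> {..<model_bound ?c}" "models M \<phi>"
      by (rule small_model[OF \<phi>])
    have fin: "finite (universe M)" by (rule finite_subset[OF M(2)]) simp
    obtain e where e: "e \<in> envs ?c" and eU: "universe (code_struct e) = universe M"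
      and ef: "\<forall>a\<in>universe M. func (code_struct e) a = func M a"
      and ep: "\<forall>i\<le>?c. preds (code_struct e) i = preds M i"
      by (rule code_model[OF M(1,2)])
    note struct = is_struct_code_struct[OF e]
    \<comment> \<open>The coded structure may differ from \<open>M\<close> in the function outside
      the universe and in predicates beyond \<open>c\<close>. The type with \<open>preds M\<close>
      as named sets sees neither, so \<open>sat_transfer\<close> still applies.\<close>
    have "graph (func M) (universe M) = graph (func (code_struct e)) (universe (code_struct e))"
      unfolding eU graph_def using ef by (intro image_cong) simp_all
    then have eq: "struct_tp ?c (Suc ?c) M (preds M) = struct_tp ?c (Suc ?c) (code_struct e) (preds M)"
      unfolding eU by (rule arg_cong)
    obtain a0 where "a0 \<in> universe M" using M(1) by (auto simp: is_struct_def)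
    then have "sat M (\<lambda>_. a0) (\<lambda>_. {}) \<phi>" using M(3) by (simp add: models_def)
    moreover have "sat M (\<lambda>_. a0) (\<lambda>_. {}) \<phi> \<longleftrightarrow> code_sat e \<phi>"
      unfolding code_sat_def
      by (rule sat_transfer[OF M(1) struct(1) fin struct(2) eq fm_rank_le_code, of id _ _ id _ _ id])
        (use \<phi> ep in \<open>simp_all add: sentence_def fm_preds_le_code less_Suc_eq_le\<close>)
    ultimately show "\<exists>e\<in>envs ?c. code_sat e \<phi>" using e by blast
  qed
  finally show ?thesis .
qed

theorem theorem8p3:
  "decidable_on fm_code {\<phi>. sentence \<phi>} has_finite_model"
proof (rule decidable_on_by_search[OF decidable_valid decidable_accepts])
  show "\<exists>T. valid T (fm_code \<phi>)" for \<phi> using valid_certificate by blast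
  show "accepts T (fm_code \<phi>) \<longleftrightarrow> has_finite_model \<phi>"
    if "\<phi> \<in> {\<phi>. sentence \<phi>}" "valid T (fm_code \<phi>)" for \<phi> T
    using that accepts_iff_has_finite_model by simp
qed

end
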